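(* Let $E$ be a compact metric space and $Y$ a Feller process on $E$ with semigroup $(T(t))_{t\ge0}$. For $n\ge1$ let $E_n$ be a compact metric space, $Y_n$ a Markov chain in $E_n$ with transition operator $T_n$, and $\gamma_n:E_n\to E$ a continuous function. Suppose that for every $y\in E$ there is a sequence $(y_n)_{n\ge1}$ with $y_n\in E_n$ and $\gamma_n(y_n)\to y$. Suppose that each $Y_n$ has a unique stationary measure $\nu_n$, that $Y$ has a unique stationary measure $\nu$, and that $\nu_n\circ\gamma_n^{-1}\to\nu$ weakly. Suppose that $(\varepsilon_n)_{n\ge1}$ is a positive sequence converging to zero such that, for all $f\in C(E)$ and $t\ge0$, $$\big\|T_n^{\lfloor t/\varepsilon_n\rfloor}(f\circ\gamma_n)-(T(t)f)\circ\gamma_n\big\|_\infty\xrightarrow[n\to\infty]{}0 .$$ Let $\Delta_n$ be the separation distance of $Y_n$, $\Delta^*_n$ the separation distance of its continuous-time variant with jump rate $1/\varepsilon_n$, and $\Delta$ the separation distance of $Y$. Then for all $t\ge0$, $$\Delta(t)\le\liminf_{n\to\infty}\Delta_n(\lfloor t/\varepsilon_n\rfloor)\qquad\text{and}\qquad\Delta(t)\le\liminf_{n\to\infty}\Delta^*_n(t).$$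
   Context: For probability measures $P,Q$ on a compact topological space $Z$, the separation distance is $\operatorname{sep}(P,Q)=\sup_{f\in C_+(Z)}\big(1-\frac{\int f\,dP}{\int f\,dQ}\big)$, where $C_+(Z)$ is the set of continuous functions $Z\to(0,\infty)$ (for finite $Z$ this equals $\max_{z:Q(z)\neq0}(1-P(z)/Q(z))$). The separation distance of a (discrete- or continuous-time) Markov process with unique stationary distribution $\nu$ is the function of time $\Delta(t)=\sup_x\operatorname{sep}(\mathrm{Law}_x(Y(t)),\nu)$, the supremum being over initial states $x$ and $\mathrm{Law}_x(Y(t))$ being the law at time $t$ of the process started at $x$. The continuous-time variant of $Y_n$ with jump rate $1/\varepsilon_n$ is the pseudo-Poisson process with semigroup $e^{t(T_n-I)/\varepsilon_n}$. $(T_nf)(x)=\mathbb E[f(Y_n(1))\mid Y_n(0)=x]$. *)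

theory Defs
  imports "HOL-Probability.Probability"
begin

section \<open>Borel measures on a topological space\<close>

definition borel_of :: "'a topology \<Rightarrow> 'a measure" where
  "borel_of Z = sigma (topspace Z) {U. openin Z U}"

definition sup_norm :: "'a set \<Rightarrow> ('a \<Rightarrow> real) \<Rightarrow> real" where
  "sup_norm S f = (SUP x\<in>S. \<bar>f x\<bar>)"

text \<open>The library's \<open>weak_conv_m\<close> is restricted to measures on the real line.\<close>

definition weakly_converges :: "'a topology \<Rightarrow> (nat \<Rightarrow> 'a measure) \<Rightarrow> 'a measure \<Rightarrow> bool" where
  "weakly_converges Z M N \<longleftrightarrow>
     (\<forall>f. continuous_map Z euclideanreal f \<and> bounded (f ` topspace Z) \<longrightarrow>
        (\<lambda>n. \<integral>x. f x \<partial>M n) \<longlonglongrightarrow> (\<integral>x. f x \<partial>N))"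

text \<open>On a compact space, for probability measures, this is a supremum of a nonempty set
  of reals bounded above by 1.\<close>

definition sep :: "'a topology \<Rightarrow> 'a measure \<Rightarrow> 'a measure \<Rightarrow> real" where
  "sep Z P Q =
     (SUP f\<in>{f. continuous_map Z euclideanreal f \<and> (\<forall>z\<in>topspace Z. 0 < f z)}.
        1 - (\<integral>z. f z \<partial>P) / (\<integral>z. f z \<partial>Q))"

section \<open>Markov processes\<close>

text \<open>A process is given together with all its initial states: \<open>pr Y x\<close> is the probability
  space on which it is started at \<open>x\<close>, and \<open>state Y t\<close> is its state at time \<open>t\<close>. Times are the
  nonnegative elements of \<open>'t\<close>, which is \<^typ>\<open>nat\<close> for chains and \<^typ>\<open>real\<close> for
  continuous-time processes.\<close>

record ('t, 'w, 's) process =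
  pr :: "'s \<Rightarrow> 'w measure"
  state :: "'t \<Rightarrow> 'w \<Rightarrow> 's"

definition law :: "'s measure \<Rightarrow> ('t, 'w, 's) process \<Rightarrow> 't \<Rightarrow> 's \<Rightarrow> 's measure" where
  "law S Y t x = distr (pr Y x) S (state Y t)"

text \<open>The operator \<open>(T\<^sub>t f)(x) = E\<^sub>x[f(Y(t))]\<close>. The transition operator of a chain is the
  case \<open>t = 1\<close>; for a continuous-time process, these operators form its semigroup.\<close>

definition transition_op :: "('t, 'w, 's) process \<Rightarrow> 't \<Rightarrow> ('s \<Rightarrow> real) \<Rightarrow> 's \<Rightarrow> real" where
  "transition_op Y t f x = (\<integral>w. f (state Y t w) \<partial>pr Y x)"

definition past :: "'s measure \<Rightarrow> ('t::{linorder,zero}, 'w, 's) process \<Rightarrow> 's \<Rightarrow> 't \<Rightarrow> 'w measure"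
  where
  "past S Y x s =
     sigma (space (pr Y x))
       {state Y u -` A \<inter> space (pr Y x) | u A. 0 \<le> u \<and> u \<le> s \<and> A \<in> sets S}"

text \<open>The last conjunct is the (time-homogeneous) Markov property
  \<open>P\<^sub>x(Y(s + t) \<in> A | Y(u), u \<le> s) = P\<^sub>y(Y(t) \<in> A)\<close> at \<open>y = Y(s)\<close>.\<close>

definition markov_process ::
  "'s measure \<Rightarrow> ('t::{linorder,monoid_add}, 'w, 's) process \<Rightarrow> bool" where
  "markov_process S Y \<longleftrightarrow>
     (\<forall>x\<in>space S. prob_space (pr Y x) \<and> (AE w in pr Y x. state Y 0 w = x)) \<and>
     (\<forall>x\<in>space S. \<forall>t\<ge>0. state Y t \<in> measurable (pr Y x) S) \<and>
     (\<forall>t\<ge>0. law S Y t \<in> measurable S (prob_algebra S)) \<and>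
     (\<forall>x\<in>space S. \<forall>s\<ge>0. \<forall>t\<ge>0. \<forall>A\<in>sets S.
        AE w in pr Y x.
          real_cond_exp (pr Y x) (past S Y x s) (\<lambda>w. indicator A (state Y (s + t) w)) w
            = measure (law S Y t (state Y s w)) A)"

definition stationary ::
  "'s measure \<Rightarrow> ('t::{linorder,zero}, 'w, 's) process \<Rightarrow> 's measure \<Rightarrow> bool" where
  "stationary S Y \<mu> \<longleftrightarrow>
     prob_space \<mu> \<and> sets \<mu> = sets S \<and> (\<forall>t\<ge>0. \<mu> \<bind> law S Y t = \<mu>)"

definition unique_stationary ::
  "'s measure \<Rightarrow> ('t::{linorder,zero}, 'w, 's) process \<Rightarrow> 's measure \<Rightarrow> bool" where
  "unique_stationary S Y \<nu> \<longleftrightarrow>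
     stationary S Y \<nu> \<and> (\<forall>\<mu>. stationary S Y \<mu> \<longrightarrow> \<mu> = \<nu>)"

text \<open>Meaningful for processes with a unique stationary distribution.\<close>

definition separation_distance ::
  "'s topology \<Rightarrow> ('t::{linorder,zero}, 'w, 's) process \<Rightarrow> 't \<Rightarrow> real" where
  "separation_distance Z Y t =
     (SUP x\<in>topspace Z.
        sep Z (law (borel_of Z) Y t x) (THE \<nu>. unique_stationary (borel_of Z) Y \<nu>))"

text \<open>Feller processes on a compact space: the semigroup preserves the space of continuous
  functions and is strongly continuous there (at 0, hence everywhere).\<close>

definition feller_process :: "'s topology \<Rightarrow> (real, 'w, 's) process \<Rightarrow> bool" where
  "feller_process Z Y \<longleftrightarrow>
     markov_process (borel_of Z) Y \<and>
     (\<forall>f. continuous_map Z euclideanreal f \<longrightarrow>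
        (\<forall>t\<ge>0. continuous_map Z euclideanreal (transition_op Y t f)) \<and>
        ((\<lambda>t. sup_norm (topspace Z) (\<lambda>x. transition_op Y t f x - f x)) \<longlongrightarrow> 0) (at_right 0))"

section \<open>The continuous-time variant of a chain\<close>

text \<open>The power series of \<open>e\<^sup>t\<^sup>A\<close>. For the operators used below it converges uniformly, since
  \<open>A = r(T - I)\<close> has norm at most \<open>2r\<close> on bounded measurable functions.\<close>

definition op_exp :: "(('s \<Rightarrow> real) \<Rightarrow> 's \<Rightarrow> real) \<Rightarrow> real \<Rightarrow> ('s \<Rightarrow> real) \<Rightarrow> 's \<Rightarrow> real" where
  "op_exp A t f x = (\<Sum>k. t ^ k / fact k * (A ^^ k) f x)"

text \<open>\<open>Y'\<close> is a pseudo-Poisson process with jump rate \<open>r\<close>, that is, with semigroup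
  \<open>exp(t r (T - I))\<close> on bounded measurable functions, where \<open>T\<close> is the transition operator of
  the chain \<open>Y\<close>.\<close>

definition continuous_time_variant ::
  "'s measure \<Rightarrow> (nat, 'w, 's) process \<Rightarrow> real \<Rightarrow> (real, 'v, 's) process \<Rightarrow> bool" where
  "continuous_time_variant S Y r Y' \<longleftrightarrow>
     markov_process S Y' \<and>
     (\<forall>f\<in>borel_measurable S. bounded (f ` space S) \<longrightarrow>
        (\<forall>t\<ge>0. \<forall>x\<in>space S.
           transition_op Y' t f x = op_exp (\<lambda>g y. r * (transition_op Y 1 g y - g y)) t f x))"

end

theory Submission
  imports Defs
begin

text \<open>Fix a positive continuous \<open>f\<close> and a state \<open>y\<close> of \<open>E\<close>, and choose \<open>y\<^sub>n\<close> with
  \<open>\<gamma>\<^sub>n(y\<^sub>n) \<rightarrow> y\<close>. Then \<open>f \<circ> \<gamma>\<^sub>n\<close> is an admissible test function for the separation at \<open>y\<^sub>n\<close>, and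
  the resulting lower bound for the separation distance converges to \<open>1 - T(t)f(y) / \<integral>f d\<nu>\<close>; taking
  suprema gives the inequality for the chains.

  The continuous-time variant has the same stationary measures as the chain, and its transition
  operator is the Poisson average of the powers \<open>T\<^sub>n\<^sup>k\<close> with mean \<open>t / \<epsilon>\<^sub>n\<close>. The Poisson law concentrates
  on \<open>\<bar>k - t / \<epsilon>\<^sub>n\<bar> = O(\<epsilon>\<^sub>n\<^sup>-\<^sup>1\<^sup>/\<^sup>2)\<close>, but the convergence hypothesis is only pointwise in time and does not
  by itself control \<open>T\<^sub>n\<^sup>k\<close> on this window. Therefore \<open>f \<circ> \<gamma>\<^sub>n\<close> is first replaced by its average over
  the powers \<open>j < \<delta> / \<epsilon>\<^sub>n\<close>. The averages are Lipschitz in \<open>k\<close> with constant \<open>O(\<epsilon>\<^sub>n / \<delta>)\<close>, and by dominated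
  convergence and strong continuity of the limit semigroup they are close to \<open>f \<circ> \<gamma>\<^sub>n\<close>.\<close>

section \<open>Poisson averages of real sequences\<close>

definition poisson_weight :: "real \<Rightarrow> nat \<Rightarrow> real" where
  "poisson_weight s k = s ^ k / fact k * exp (- s)"

lemma poisson_weight_nonneg: "0 \<le> s \<Longrightarrow> 0 \<le> poisson_weight s k"
  by (simp add: poisson_weight_def)

lemma poisson_weight_sums: "poisson_weight s sums 1"
proof -
  have "(\<lambda>k. s ^ k /\<^sub>R fact k * exp (- s)) sums (exp s * exp (- s))"
    by (intro sums_mult2 exp_converges)
  then show ?thesis
    by (simp add: poisson_weight_def[abs_def] divide_inverse mult_ac flip: exp_add)
qed

text \<open>The factor \<open>Suc k\<close> cancels against the factorial. A factor \<open>k\<close>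
  is thereby absorbed into an index shift, so the moments below reduce to the total mass.\<close>

lemma poisson_weight_Suc: "real (Suc k) * poisson_weight s (Suc k) = s * poisson_weight s k"
proof -
  have "poisson_weight s (Suc k) = s * s ^ k / (real (Suc k) * fact k) * exp (- s)"
    by (simp add: poisson_weight_def)
  then show ?thesis
    by (simp add: poisson_weight_def del: of_nat_Suc)
qed

lemma poisson_weight_mean: "(\<lambda>k. real k * poisson_weight s k) sums s"
proof -
  have "(\<lambda>k. real (Suc k) * poisson_weight s (Suc k)) sums (s * 1)"
    by (simp only: poisson_weight_Suc) (intro sums_mult poisson_weight_sums)
  \<comment> \<open>The missing term at index 0 is zero because of the factor
    \<open>k\<close>.\<close>
  from sums_Suc[OF this] show ?thesis by simp
qed

text \<open>Shifting the index once reduces the second factorial moment to the mean and gives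
  \<open>s\<^sup>2\<close>; then
  \<open>(k - s)\<^sup>2 = k * (k - 1) + (1 - 2 * s) * k + s\<^sup>2\<close>.\<close>

lemma poisson_weight_variance: "(\<lambda>k. (real k - s)\<^sup>2 * poisson_weight s k) sums s"
proof -
  have "real (Suc k) * (real (Suc k) - 1) * poisson_weight s (Suc k)
      = s * (real k * poisson_weight s k)" for k
  proof -
    have "real (Suc k) * (real (Suc k) - 1) * poisson_weight s (Suc k)
        = real k * (real (Suc k) * poisson_weight s (Suc k))"
      by (simp add: algebra_simps)
    also have "\<dots> = s * (real k * poisson_weight s k)"
      by (simp only: poisson_weight_Suc) (simp add: algebra_simps)
    finally show ?thesis .
  qed
  then have "(\<lambda>k. real (Suc k) * (real (Suc k) - 1) * poisson_weight s (Suc k)) sums (s * s)"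
    using sums_mult[OF poisson_weight_mean, of s s] by (simp only:)
  from sums_Suc[OF this]
  have "(\<lambda>k. (real k * (real k - 1)) * poisson_weight s k) sums s\<^sup>2"
    by (simp add: power2_eq_square)
  from sums_add[OF sums_add[OF this sums_mult[OF poisson_weight_mean, of "1 - 2 * s"]]
      sums_mult[OF poisson_weight_sums, of "s\<^sup>2"]]
  have "(\<lambda>k. real k * (real k - 1) * poisson_weight s k
        + (1 - 2 * s) * (real k * poisson_weight s k) + s\<^sup>2 * poisson_weight s k) sums
      (s\<^sup>2 + (1 - 2 * s) * s + s\<^sup>2 * 1)"
    by simp
  moreover have "real k * (real k - 1) * poisson_weight s k
        + (1 - 2 * s) * (real k * poisson_weight s k) + s\<^sup>2 * poisson_weight s k
      = (real k - s)\<^sup>2 * poisson_weight s k" for k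
    by (simp add: power2_eq_square algebra_simps)
  ultimately show ?thesis
    by (simp add: power2_eq_square algebra_simps)
qed

section \<open>Distance of a Poisson average from the term at the floor of its mean\<close>

lemma summable_poisson_weight_mult:
  fixes a :: "nat \<Rightarrow> real"
  assumes "0 \<le> s" "\<And>k. \<bar>a k\<bar> \<le> M"
  shows "summable (\<lambda>k. poisson_weight s k * a k)"
proof (rule summable_comparison_test'[where N = 0])
  show "summable (\<lambda>k. poisson_weight s k * M)"
    using poisson_weight_sums by (intro summable_mult2) (rule sums_summable)
  show "norm (poisson_weight s k * a k) \<le> poisson_weight s k * M" for k
    using assms poisson_weight_nonneg[OF assms(1), of k] by (simp add: abs_mult mult_left_mono)
qed

text \<open>Both terms are compared with their moving averages over \<open>m\<close> steps, which move by at most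
  \<open>2 M / m\<close> per step.\<close>

lemma moving_average_bound:
  fixes a b :: "nat \<Rightarrow> real"
  assumes M: "\<And>k. \<bar>a k\<bar> \<le> M"
    and b: "\<And>k j. \<bar>a (k + j) - a k\<bar> \<le> b j"
    and m: "m \<ge> 1"
  shows "\<bar>a k - a l\<bar> \<le> 2 * ((\<Sum>j<m. b j) / m) + 2 * M / m * \<bar>real k - real l\<bar>"
proof -
  define A where "A k = (\<Sum>j<m. a (k + j)) / m" for k
  have A: "\<bar>A k - a k\<bar> \<le> (\<Sum>j<m. b j) / m" for k
  proof -
    have "A k - a k = (\<Sum>j<m. a (k + j) - a k) / m"
      using m by (simp add: A_def sum_subtractf field_simps)
    also have "\<bar>\<dots>\<bar> \<le> (\<Sum>j<m. \<bar>a (k + j) - a k\<bar>) / m"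
      by (simp add: divide_right_mono)
    also have "\<dots> \<le> (\<Sum>j<m. b j) / m"
      by (intro divide_right_mono sum_mono b) simp
    finally show ?thesis .
  qed
  have step: "\<bar>A (Suc k) - A k\<bar> \<le> 2 * M / m" for k
  proof -
    \<comment> \<open>Telescoping: windows shifted by one differ only in their end terms.\<close>
    have "(\<Sum>j<m. a (Suc k + j)) - (\<Sum>j<m. a (k + j)) = a (k + m) - a k"
      by (induction m) auto
    then have "A (Suc k) - A k = (a (k + m) - a k) / m"
      by (simp add: A_def flip: diff_divide_distrib)
    also have "\<bar>\<dots>\<bar> \<le> 2 * M / m"
      using M[of "k + m"] M[of k] by (simp add: divide_right_mono)
    finally show ?thesis .
  qed
  have far: "\<bar>A (k + i) - A k\<bar> \<le> 2 * M / m * real i" for k i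
  proof (induction i)
    case (Suc i)
    have "2 * M / m * real (Suc i) = 2 * M / m * real i + 2 * M / m"
      by (simp add: distrib_left)
    then show ?case using Suc step[of "k + i"] by simp
  qed simp
  have "\<bar>A k - A l\<bar> \<le> 2 * M / m * \<bar>real k - real l\<bar>"
  proof (cases "k \<le> l")
    case True
    then show ?thesis using far[of k "l - k"] by (simp add: abs_minus_commute)
  next
    case False
    then show ?thesis using far[of l "k - l"] by simp
  qed
  then show ?thesis using A[of k] A[of l] by simp
qed

text \<open>Each \<open>a k\<close> is compared with \<open>a l\<close>, where \<open>l\<close> is
  the integer part of the mean \<open>s = t / \<epsilon>\<close>, by
  \<open>moving_average_bound\<close>. It remains to average
  \<open>\<bar>k - l\<bar> \<le> \<bar>k - s\<bar> + 1\<close>, which the variance controls: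
  \<open>\<epsilon> * \<bar>k - s\<bar>\<close> is typically of order
  \<open>sqrt (\<epsilon> * t)\<close>.\<close>

lemma poisson_average_bound:
  fixes a b :: "nat \<Rightarrow> real"
  assumes M: "\<And>k. \<bar>a k\<bar> \<le> M"
    and b: "\<And>k j. \<bar>a (k + j) - a k\<bar> \<le> b j"
    and m: "m \<ge> 1" and \<epsilon>: "\<epsilon> > 0" and t: "t \<ge> 0"
  shows "\<bar>(\<Sum>k. poisson_weight (t / \<epsilon>) k * a k) - a (nat \<lfloor>t / \<epsilon>\<rfloor>)\<bar>
    \<le> 2 * ((\<Sum>j<m. b j) / m) + 2 * M / (m * \<epsilon>) * (sqrt \<epsilon> * (1 + t) / 2 + \<epsilon>)"
proof -
  define s where "s = t / \<epsilon>"
  define l where "l = nat \<lfloor>s\<rfloor>"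
  define p where "p = poisson_weight s"
  define \<beta> where "\<beta> = (\<Sum>j<m. b j) / m"
  define C where "C = 2 * M / (m * \<epsilon>)"
  have s: "s \<ge> 0" and s\<epsilon>: "\<epsilon> * s = t" using \<epsilon> t by (auto simp: s_def)
  have p0: "p k \<ge> 0" for k using s by (simp add: p_def poisson_weight_nonneg)
  have C0: "C \<ge> 0" using M[of 0] \<epsilon> m by (auto simp: C_def)
  have sl: "\<bar>s - real l\<bar> \<le> 1"
    using s unfolding l_def by linarith
  \<comment> \<open>A termwise majorant whose sum is the claimed bound, because the weights sum to 1
    and \<open>\<epsilon>\<close> times the variance \<open>s\<close> is \<open>t\<close>.\<close>
  define h where "h k = (2 * \<beta> + C * (sqrt \<epsilon> / 2 + \<epsilon>)) * p k
      + C * (sqrt \<epsilon> * \<epsilon> / 2) * ((real k - s)\<^sup>2 * p k)" for k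
  have h: "h sums ((2 * \<beta> + C * (sqrt \<epsilon> / 2 + \<epsilon>)) * 1 + C * (sqrt \<epsilon> * \<epsilon> / 2) * s)"
    unfolding h_def p_def
    by (intro sums_add sums_mult poisson_weight_sums poisson_weight_variance)
  have bound: "\<bar>p k * (a k - a l)\<bar> \<le> h k" for k
  proof -
    define d where "d = real k - s"
    \<comment> \<open>AM-GM replaces the absolute deviation by its square, whose Poisson mean is
      known. The weight \<open>sqrt \<epsilon>\<close> is chosen so that the resulting bound on
      \<open>\<epsilon> * \<bar>d\<bar>\<close> has a mean of order
      \<open>sqrt \<epsilon>\<close>.\<close>
    have "0 \<le> (sqrt \<epsilon> * \<bar>d\<bar> - 1)\<^sup>2" by simp
    then have "2 * (sqrt \<epsilon> * \<bar>d\<bar>) \<le> \<epsilon> * d\<^sup>2 + 1"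
      using \<epsilon> by (simp add: power2_diff power_mult_distrib)
    then have "sqrt \<epsilon> * (2 * (sqrt \<epsilon> * \<bar>d\<bar>)) \<le> sqrt \<epsilon> * (\<epsilon> * d\<^sup>2 + 1)"
      using \<epsilon> by (intro mult_left_mono) auto
    moreover have "sqrt \<epsilon> * (2 * (sqrt \<epsilon> * \<bar>d\<bar>)) = 2 * (\<epsilon> * \<bar>d\<bar>)"
      using \<epsilon> by (simp add: mult.assoc[symmetric]) 
    ultimately have d: "\<epsilon> * \<bar>d\<bar> \<le> sqrt \<epsilon> * (\<epsilon> * d\<^sup>2 + 1) / 2"
      by simp
    have "\<epsilon> * \<bar>real k - real l\<bar> \<le> \<epsilon> * (\<bar>d\<bar> + 1)"
      using sl \<epsilon> by (intro mult_left_mono) (auto simp: d_def)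
    also have "\<dots> \<le> sqrt \<epsilon> * (\<epsilon> * d\<^sup>2 + 1) / 2 + \<epsilon>"
      using d by (simp add: distrib_left)
    finally have *: "C * (\<epsilon> * \<bar>real k - real l\<bar>) \<le> C * (sqrt \<epsilon> * (\<epsilon> * d\<^sup>2 + 1) / 2 + \<epsilon>)"
      using C0 by (rule mult_left_mono)
    have "\<bar>a k - a l\<bar> \<le> 2 * \<beta> + C * (\<epsilon> * \<bar>real k - real l\<bar>)"
      using moving_average_bound[of a M b m k l, OF M b m] \<epsilon> m
      by (simp add: \<beta>_def C_def)
    with * have "\<bar>a k - a l\<bar> \<le> 2 * \<beta> + C * (sqrt \<epsilon> * (\<epsilon> * d\<^sup>2 + 1) / 2 + \<epsilon>)"
      by linarith
    then have "p k * \<bar>a k - a l\<bar> \<le> p k * (2 * \<beta> + C * (sqrt \<epsilon> * (\<epsilon> * d\<^sup>2 + 1) / 2 + \<epsilon>))"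
      using p0 by (rule mult_left_mono)
    also have "\<dots> = h k"
      unfolding h_def d_def[symmetric] by (simp add: field_simps)
    finally show ?thesis using p0[of k] by (simp add: abs_mult)
  qed
  have sm: "summable (\<lambda>k. p k * a k)"
    unfolding p_def by (rule summable_poisson_weight_mult[OF s M])
  have "(\<lambda>k. p k * a k - p k * a l) sums ((\<Sum>k. p k * a k) - 1 * a l)"
    unfolding p_def using sm[unfolded p_def]
    by (intro sums_diff summable_sums sums_mult2 poisson_weight_sums)
  then have d: "(\<lambda>k. p k * (a k - a l)) sums ((\<Sum>k. p k * a k) - a l)"
    by (simp add: right_diff_distrib)
  have abs: "summable (\<lambda>k. \<bar>p k * (a k - a l)\<bar>)"
    by (rule summable_comparison_test'[OF sums_summable[OF h], where N = 0]) (use bound in auto)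
  have "\<bar>(\<Sum>k. p k * a k) - a l\<bar> \<le> (\<Sum>k. \<bar>p k * (a k - a l)\<bar>)"
    using summable_rabs[OF abs] sums_unique[OF d] by simp
  also have "\<dots> \<le> (\<Sum>k. h k)"
    by (intro suminf_le bound abs sums_summable[OF h])
  also have "\<dots> = 2 * \<beta> + C * (sqrt \<epsilon> * (1 + t) / 2 + \<epsilon>)"
    unfolding sums_unique[OF h, symmetric] s\<epsilon>[symmetric] by (simp add: field_simps)
  finally show ?thesis by (simp add: p_def s_def l_def \<beta>_def C_def)
qed

section \<open>From smallness at each single time to convergence of Poisson averages\<close>

text \<open>The left side is the integral of a step function with cells of length
  \<open>\<epsilon>\<close>. The first \<open>m\<close> cells lie in \<open>{0..\<delta>}\<close>,
  and the rest of the interval contributes a nonnegative amount. In this form averages over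
  \<open>j < m\<close> become integrals over a fixed interval, to which dominated convergence
  applies.\<close>

lemma sum_le_integral_floor:
  fixes c :: "nat \<Rightarrow> real"
  assumes c: "\<And>j. 0 \<le> c j" "\<And>j. c j \<le> K" and \<epsilon>: "\<epsilon> > 0" and m: "m * \<epsilon> \<le> \<delta>"
  shows "\<epsilon> * (\<Sum>j<m. c j) \<le> (\<integral>s. indicator {0..\<delta>} s * c (nat \<lfloor>s / \<epsilon>\<rfloor>) \<partial>lborel)"
proof -
  define J where "J j = {real j * \<epsilon>..<real (Suc j) * \<epsilon>}" for j
  \<comment> \<open>As \<open>nat\<close> sends negative integers to 0, the conjunct
    \<open>0 \<le> s\<close> is what keeps negative \<open>s\<close> out of cell 0.\<close>
  have J: "s \<in> J j \<longleftrightarrow> 0 \<le> s \<and> nat \<lfloor>s / \<epsilon>\<rfloor> = j" for s j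
  proof -
    have "s \<in> J j \<longleftrightarrow> real j \<le> s / \<epsilon> \<and> s / \<epsilon> < real j + 1"
      using \<epsilon> by (auto simp: J_def field_simps)
    also have "\<dots> \<longleftrightarrow> 0 \<le> s / \<epsilon> \<and> nat \<lfloor>s / \<epsilon>\<rfloor> = j"
      by linarith
    finally show ?thesis using \<epsilon> by (simp add: zero_le_divide_iff)
  qed
  have meas: "(\<lambda>s. c (nat \<lfloor>s / \<epsilon>\<rfloor>)) \<in> borel_measurable lborel"
    by measurable
  have "\<epsilon> * (\<Sum>j<m. c j) = (\<Sum>j<m. c j * measure lborel (J j))"
    using \<epsilon> by (simp add: J_def sum_distrib_left algebra_simps)
  also have "\<dots> = (\<integral>s. (\<Sum>j<m. c j * indicator (J j) s) \<partial>lborel)"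
    using \<epsilon> by (subst Bochner_Integration.integral_sum) (auto simp: J_def)
  also have "\<dots> \<le> (\<integral>s. indicator {0..\<delta>} s * c (nat \<lfloor>s / \<epsilon>\<rfloor>) \<partial>lborel)"
  proof (rule integral_mono)
    show "integrable lborel (\<lambda>s. \<Sum>j<m. c j * indicator (J j) s)"
      by (intro Bochner_Integration.integrable_sum integrable_mult_right integrable_real_indicator)
        (use \<epsilon> in \<open>auto simp: J_def\<close>)
    show "integrable lborel (\<lambda>s. indicator {0..\<delta>} s * c (nat \<lfloor>s / \<epsilon>\<rfloor>))"
    proof (rule Bochner_Integration.integrable_bound[where f = "\<lambda>s. K * indicator {0..\<delta>} s"])
      show "AE s in lborel. norm (indicator {0..\<delta>} s * c (nat \<lfloor>s / \<epsilon>\<rfloor>)) \<le> norm (K * indicator {0..\<delta>} s)"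
        using c by (auto simp: indicator_def intro!: order_trans[OF c(2)])
      show "integrable lborel (\<lambda>s. K * indicator {0..\<delta>} s)"
        by (intro integrable_mult_right integrable_real_indicator) (auto simp: emeasure_lborel_Icc_eq)
    qed auto
    show "(\<Sum>j<m. c j * indicator (J j) s) \<le> indicator {0..\<delta>} s * c (nat \<lfloor>s / \<epsilon>\<rfloor>)" for s
    proof (cases "0 \<le> s \<and> nat \<lfloor>s / \<epsilon>\<rfloor> < m")
      case True
      then have "(\<Sum>j<m. c j * indicator (J j) s) = (\<Sum>j<m. if nat \<lfloor>s / \<epsilon>\<rfloor> = j then c j else 0)"
        by (intro sum.cong) (auto simp: J indicator_def)
      moreover have "s / \<epsilon> < m" using True by linarith
      then have "s \<le> \<delta>" using \<epsilon> m by (simp add: field_simps)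
      ultimately show ?thesis using True by simp
    next
      case False
      then have "(\<Sum>j<m. c j * indicator (J j) s) = 0"
        by (intro sum.neutral) (auto simp: J indicator_def)
      then show ?thesis using c(1) by simp
    qed
  qed
  finally show ?thesis .
qed

lemma tendsto_floor_mult:
  fixes \<epsilon> :: "nat \<Rightarrow> real"
  assumes \<epsilon>: "\<And>n. \<epsilon> n > 0" "\<epsilon> \<longlonglongrightarrow> 0" and \<delta>: "\<delta> \<ge> 0"
  shows "(\<lambda>n. real (nat \<lfloor>\<delta> / \<epsilon> n\<rfloor>) * \<epsilon> n) \<longlonglongrightarrow> \<delta>"
proof (rule real_tendsto_sandwich)
  have *: "real (nat \<lfloor>\<delta> / \<epsilon> n\<rfloor>) \<le> \<delta> / \<epsilon> n" "\<delta> / \<epsilon> n - 1 \<le> real (nat \<lfloor>\<delta> / \<epsilon> n\<rfloor>)" for n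
    using \<epsilon>(1)[of n] \<delta> by (simp add: zero_le_divide_iff, linarith)
  show "\<forall>\<^sub>F n in sequentially. \<delta> - \<epsilon> n \<le> real (nat \<lfloor>\<delta> / \<epsilon> n\<rfloor>) * \<epsilon> n"
    using *(2) \<epsilon>(1) by (intro always_eventually allI) (simp add: field_simps)
  show "\<forall>\<^sub>F n in sequentially. real (nat \<lfloor>\<delta> / \<epsilon> n\<rfloor>) * \<epsilon> n \<le> \<delta>"
    using *(1) \<epsilon>(1) by (intro always_eventually allI) (simp add: field_simps)
  show "(\<lambda>n. \<delta> - \<epsilon> n) \<longlonglongrightarrow> \<delta>"
    using tendsto_diff[OF tendsto_const \<epsilon>(2), of \<delta>] by simp
qed simp

text \<open>The parameter \<open>\<delta>\<close> is fixed before \<open>n\<close> grows: the error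
  of the moving average is then governed by the mean of \<open>b n\<close> over
  \<open>{0..\<delta>}\<close>, while the Lipschitz error is of order
  \<open>sqrt (\<epsilon> n) / \<delta>\<close> and vanishes.\<close>

lemma poisson_average_tendsto:
  fixes a b :: "nat \<Rightarrow> nat \<Rightarrow> real" and \<epsilon> :: "nat \<Rightarrow> real"
  assumes \<epsilon>: "\<And>n. \<epsilon> n > 0" "\<epsilon> \<longlonglongrightarrow> 0"
    and M: "\<And>n k. \<bar>a n k\<bar> \<le> M"
    and b: "\<And>n k j. \<bar>a n (k + j) - a n k\<bar> \<le> b n j" "\<And>n j. b n j \<le> K"
    and small: "\<And>\<eta>. \<eta> > 0 \<Longrightarrow>
      \<exists>\<delta>>0. \<forall>s\<in>{0..\<delta>}. \<forall>\<^sub>F n in sequentially. b n (nat \<lfloor>s / \<epsilon> n\<rfloor>) \<le> \<eta>"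
    and t: "t \<ge> 0"
  shows "(\<lambda>n. (\<Sum>k. poisson_weight (t / \<epsilon> n) k * a n k) - a n (nat \<lfloor>t / \<epsilon> n\<rfloor>)) \<longlonglongrightarrow> 0"
proof (rule LIMSEQ_I)
  fix e :: real assume "e > 0"
  \<comment> \<open>The final bound \<open>R n\<close> tends to \<open>2 * \<eta> = e / 2\<close>,
    strictly below \<open>e\<close>.\<close>
  define \<eta> where "\<eta> = e / 4"
  have \<eta>: "\<eta> > 0" using \<open>e > 0\<close> by (simp add: \<eta>_def)
  obtain \<delta> where \<delta>: "\<delta> > 0"
    and small\<delta>: "\<And>s. s \<in> {0..\<delta>} \<Longrightarrow> \<forall>\<^sub>F n in sequentially. b n (nat \<lfloor>s / \<epsilon> n\<rfloor>) \<le> \<eta>"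
    using small[OF \<eta>] by blast
  \<comment> \<open>The excess over \<open>\<eta>\<close> is used because, at each fixed time, it is
    eventually exactly 0, whereas \<open>b\<close> itself need not converge.\<close>
  define c where "c n j = max 0 (b n j - \<eta>)" for n j
  define m where "m n = nat \<lfloor>\<delta> / \<epsilon> n\<rfloor>" for n
  define I where "I n = (\<integral>s. indicator {0..\<delta>} s * c n (nat \<lfloor>s / \<epsilon> n\<rfloor>) \<partial>lborel)" for n
  have b0: "0 \<le> b n j" for n j using b(1)[of n 0 j] by linarith
  have c: "0 \<le> c n j" "c n j \<le> K" "b n j \<le> \<eta> + c n j" for n j
    using b(2)[of n j] b0[of n j] \<eta> by (auto simp: c_def)
  \<comment> \<open>In \<open>small\<delta>\<close> the threshold for \<open>n\<close> may depend on
    \<open>s\<close>; dominated convergence with majorant \<open>K\<close> on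
    \<open>{0..\<delta>}\<close> removes this dependence.\<close>
  have "I \<longlonglongrightarrow> (\<integral>s. 0 \<partial>(lborel :: real measure))"
    unfolding I_def
  proof (rule integral_dominated_convergence[where w = "\<lambda>s. K * indicator {0..\<delta>} s"])
    show "AE s in lborel. (\<lambda>n. indicator {0..\<delta>} s * c n (nat \<lfloor>s / \<epsilon> n\<rfloor>)) \<longlonglongrightarrow> 0"
    proof (rule AE_I2)
      fix s :: real
      show "(\<lambda>n. indicator {0..\<delta>} s * c n (nat \<lfloor>s / \<epsilon> n\<rfloor>)) \<longlonglongrightarrow> 0"
      proof (cases "s \<in> {0..\<delta>}")
        case True
        have "\<forall>\<^sub>F n in sequentially. 0 = indicator {0..\<delta>} s * c n (nat \<lfloor>s / \<epsilon> n\<rfloor>)"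
          using small\<delta>[OF True] by eventually_elim (simp add: c_def)
        then show ?thesis by (rule Lim_transform_eventually[OF tendsto_const])
      qed simp
    qed
    show "AE s in lborel. norm (indicator {0..\<delta>} s * c n (nat \<lfloor>s / \<epsilon> n\<rfloor>)) \<le> K * indicator {0..\<delta>} s"
      for n
      using c(1,2) by (auto simp: indicator_def)
    show "integrable lborel (\<lambda>s. K * indicator {0..\<delta>} s)"
      by (intro integrable_mult_right integrable_real_indicator) (use \<delta> in auto)
  qed auto
  then have I: "I \<longlonglongrightarrow> 0" by simp
  have m: "(\<lambda>n. real (m n) * \<epsilon> n) \<longlonglongrightarrow> \<delta>"
    unfolding m_def using \<epsilon> \<delta> by (intro tendsto_floor_mult) auto
  \<comment> \<open>This is the bound of \<open>poisson_average_bound\<close> with the mean of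
    \<open>b n\<close> replaced by \<open>\<eta>\<close> plus the mean excess. The denominators
    \<open>m n * \<epsilon> n\<close> tend to \<open>\<delta> > 0\<close>, so the limit can be taken
    term by term.\<close>
  define R where "R n = 2 * (\<eta> + I n / (m n * \<epsilon> n))
      + 2 * M / (m n * \<epsilon> n) * (sqrt (\<epsilon> n) * (1 + t) / 2 + \<epsilon> n)" for n
  have "R \<longlonglongrightarrow> 2 * (\<eta> + 0 / \<delta>) + 2 * M / \<delta> * (sqrt 0 * (1 + t) / 2 + 0)"
    unfolding R_def using \<delta> by (intro tendsto_intros I m \<epsilon>(2)) auto
  then have "R \<longlonglongrightarrow> e / 2" by (simp add: \<eta>_def)
  then have "\<forall>\<^sub>F n in sequentially. R n < e"
    by (rule order_tendstoD(2)) (use \<open>e > 0\<close> in simp)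
  moreover have "\<forall>\<^sub>F n in sequentially. real (m n) * \<epsilon> n > 0"
    using m \<delta> by (rule order_tendstoD(1))
  ultimately have "\<forall>\<^sub>F n in sequentially.
      \<bar>(\<Sum>k. poisson_weight (t / \<epsilon> n) k * a n k) - a n (nat \<lfloor>t / \<epsilon> n\<rfloor>)\<bar> < e"
  proof eventually_elim
    case (elim n)
    then have m1: "m n \<ge> 1" using \<epsilon>(1)[of n] by (cases "m n") auto
    have "real (m n) \<le> \<delta> / \<epsilon> n"
      using \<epsilon>(1)[of n] \<delta> unfolding m_def by (simp add: zero_le_divide_iff)
    then have "m n * \<epsilon> n \<le> \<delta>"
      using \<epsilon>(1)[of n] by (simp add: field_simps)
    then have "\<epsilon> n * (\<Sum>j<m n. c n j) \<le> I n"
      unfolding I_def using c \<epsilon>(1)[of n] by (intro sum_le_integral_floor) auto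
    then have cI: "(\<Sum>j<m n. c n j) / m n \<le> I n / (m n * \<epsilon> n)"
      using m1 \<epsilon>(1)[of n] by (simp add: field_simps)
    have "(\<Sum>j<m n. b n j) / m n \<le> (\<Sum>j<m n. \<eta> + c n j) / m n"
      by (intro divide_right_mono sum_mono c) simp
    also have "\<dots> = \<eta> + (\<Sum>j<m n. c n j) / m n"
      using m1 by (simp add: sum.distrib add_divide_distrib)
    finally have "(\<Sum>j<m n. b n j) / m n \<le> \<eta> + I n / (m n * \<epsilon> n)"
      using cI by simp
    then have "\<bar>(\<Sum>k. poisson_weight (t / \<epsilon> n) k * a n k) - a n (nat \<lfloor>t / \<epsilon> n\<rfloor>)\<bar> \<le> R n"
      unfolding R_def
      by (intro order_trans[OF poisson_average_bound[of "a n" M "b n" "m n" "\<epsilon> n" t, OF M b(1) m1 \<epsilon>(1) t]]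
          add_right_mono mult_left_mono) auto
    then show ?case using elim by simp
  qed
  then show "\<exists>N. \<forall>n\<ge>N. norm ((\<Sum>k. poisson_weight (t / \<epsilon> n) k * a n k) - a n (nat \<lfloor>t / \<epsilon> n\<rfloor>) - 0) < e"
    by (simp add: eventually_sequentially)
qed

section \<open>Markov operators\<close>

definition bounded_measurable :: "'s measure \<Rightarrow> ('s \<Rightarrow> real) set" where
  "bounded_measurable S = {f \<in> borel_measurable S. bounded (f ` space S)}"

lemma bounded_measurableI:
  "f \<in> borel_measurable S \<Longrightarrow> (\<And>x. x \<in> space S \<Longrightarrow> \<bar>f x\<bar> \<le> c) \<Longrightarrow> f \<in> bounded_measurable S"
  by (auto simp: bounded_measurable_def bounded_iff)

lemma bounded_measurableE:
  assumes "f \<in> bounded_measurable S"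
  obtains c where "0 \<le> c" "\<And>x. x \<in> space S \<Longrightarrow> \<bar>f x\<bar> \<le> c"
  using assms unfolding bounded_measurable_def bounded_pos by (auto intro: less_imp_le)

lemma bounded_measurableD[measurable_dest]: "f \<in> bounded_measurable S \<Longrightarrow> f \<in> borel_measurable S"
  by (simp add: bounded_measurable_def)

lemma bounded_measurable_lincomb:
  assumes f: "f \<in> bounded_measurable S" and g: "g \<in> bounded_measurable S"
  shows "(\<lambda>x. c * f x + g x) \<in> bounded_measurable S"
proof -
  obtain a b where ab: "\<And>x. x \<in> space S \<Longrightarrow> \<bar>f x\<bar> \<le> a" "\<And>x. x \<in> space S \<Longrightarrow> \<bar>g x\<bar> \<le> b"
    using bounded_measurableE[OF f] bounded_measurableE[OF g] by metis
  show ?thesis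
  proof (rule bounded_measurableI)
    show "(\<lambda>x. c * f x + g x) \<in> borel_measurable S"
      using f g by measurable
    fix x assume "x \<in> space S"
    then show "\<bar>c * f x + g x\<bar> \<le> \<bar>c\<bar> * a + b"
      using ab by (intro order_trans[OF abs_triangle_ineq] add_mono) (auto simp: abs_mult mult_left_mono)
  qed
qed

lemma bounded_measurable_const: "(\<lambda>x. c) \<in> bounded_measurable S"
  by (rule bounded_measurableI[where c = "\<bar>c\<bar>"]) auto

lemma bounded_measurable_sum:
  assumes "\<And>j. j \<in> J \<Longrightarrow> F j \<in> bounded_measurable S"
  shows "(\<lambda>x. \<Sum>j\<in>J. c j * F j x) \<in> bounded_measurable S"
  using assms
  by (induction J rule: infinite_finite_induct)
     (auto intro: bounded_measurable_lincomb bounded_measurable_const)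

lemma integrable_bounded_measurable:
  assumes "prob_space \<mu>" "sets \<mu> = sets S" "f \<in> bounded_measurable S"
  shows "integrable \<mu> f"
proof -
  interpret prob_space \<mu> by fact
  have [simp]: "space \<mu> = space S" using assms(2) by (rule sets_eq_imp_space_eq)
  obtain c where "\<And>x. x \<in> space S \<Longrightarrow> \<bar>f x\<bar> \<le> c"
    using bounded_measurableE[OF assms(3)] by metis
  moreover have "f \<in> borel_measurable \<mu>"
    using bounded_measurableD[OF assms(3)] by (simp cong: measurable_cong_sets add: assms(2))
  ultimately show ?thesis
    by (intro integrable_const_bound[where B = c]) auto
qed

lemma integral_le_bound:
  fixes f :: "'s \<Rightarrow> real"
  assumes "prob_space \<mu>" "\<And>x. x \<in> space \<mu> \<Longrightarrow> \<bar>f x\<bar> \<le> c"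
  shows "\<bar>\<integral>x. f x \<partial>\<mu>\<bar> \<le> c"
proof (cases "integrable \<mu> f")
  case True
  interpret prob_space \<mu> by fact
  have "\<bar>\<integral>x. f x \<partial>\<mu>\<bar> \<le> (\<integral>x. \<bar>f x\<bar> \<partial>\<mu>)"
    by (rule integral_abs_bound)
  also have "\<dots> \<le> (\<integral>x. c \<partial>\<mu>)"
    using True assms(2) by (intro integral_mono) auto
  finally show ?thesis by (simp add: prob_space)
next
  case False
  interpret prob_space \<mu> by fact
  \<comment> \<open>The integral of a non-integrable function is 0 by convention, so only the sign
    of \<open>c\<close> matters; a probability space has a point at which \<open>c\<close> bounds an
    absolute value.\<close>
  have "0 \<le> c" using not_empty assms(2) by force
  then show ?thesis using False by (simp add: not_integrable_integral_eq)
qed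

section \<open>Linear contractions and the exponential of their generator\<close>

text \<open>Abstracts the transition operator of one time step. Operators act on functions on the
  whole type, whose values outside \<open>space S\<close> are uncontrolled; hence linearity and the
  bound are required only at points of \<open>space S\<close>.\<close>

locale markov_operator =
  fixes S :: "'s measure" and T :: "('s \<Rightarrow> real) \<Rightarrow> 's \<Rightarrow> real"
  assumes closed: "f \<in> bounded_measurable S \<Longrightarrow> T f \<in> bounded_measurable S"
    and lincomb: "\<lbrakk>f \<in> bounded_measurable S; g \<in> bounded_measurable S; x \<in> space S\<rbrakk>
      \<Longrightarrow> T (\<lambda>y. c * f y + g y) x = c * T f x + T g x"
    and contraction: "\<lbrakk>f \<in> bounded_measurable S; \<And>y. y \<in> space S \<Longrightarrow> \<bar>f y\<bar> \<le> b; x \<in> space S\<rbrakk>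
      \<Longrightarrow> \<bar>T f x\<bar> \<le> b"
begin

lemma diff_le:
  assumes "f \<in> bounded_measurable S" "g \<in> bounded_measurable S"
    "\<And>y. y \<in> space S \<Longrightarrow> \<bar>f y - g y\<bar> \<le> c" "x \<in> space S"
  shows "\<bar>T f x - T g x\<bar> \<le> c"
proof -
  have "\<bar>T (\<lambda>y. (- 1) * g y + f y) x\<bar> \<le> c"
    using assms by (intro contraction bounded_measurable_lincomb) auto
  then show ?thesis using lincomb[OF assms(2,1,4), of "- 1"] by simp
qed

text \<open>The contraction bound with constant 0 shows that values of the argument outside
  \<open>space S\<close> have no influence.\<close>

lemma cong:
  assumes "f \<in> bounded_measurable S" "g \<in> bounded_measurable S"
    "\<And>y. y \<in> space S \<Longrightarrow> f y = g y" "x \<in> space S"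
  shows "T f x = T g x"
  using diff_le[of f g 0 x] assms by auto

lemma pow_closed: "f \<in> bounded_measurable S \<Longrightarrow> (T ^^ k) f \<in> bounded_measurable S"
  by (induction k) (auto intro: closed)

lemma pow_contraction:
  assumes "f \<in> bounded_measurable S" "\<And>y. y \<in> space S \<Longrightarrow> \<bar>f y\<bar> \<le> b" "x \<in> space S"
  shows "\<bar>(T ^^ k) f x\<bar> \<le> b"
  using assms by (induction k arbitrary: x) (auto intro!: contraction pow_closed)

lemma pow_diff_le:
  assumes "f \<in> bounded_measurable S" "g \<in> bounded_measurable S"
    "\<And>y. y \<in> space S \<Longrightarrow> \<bar>f y - g y\<bar> \<le> c" "x \<in> space S"
  shows "\<bar>(T ^^ k) f x - (T ^^ k) g x\<bar> \<le> c"
  using assms by (induction k arbitrary: x) (auto intro!: diff_le pow_closed)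

lemma sum:
  assumes "finite J" "\<And>j. j \<in> J \<Longrightarrow> F j \<in> bounded_measurable S" "x \<in> space S"
  shows "T (\<lambda>y. \<Sum>j\<in>J. c j * F j y) x = (\<Sum>j\<in>J. c j * T (F j) x)"
  using assms
proof (induction J)
  case empty
  then show ?case using contraction[OF bounded_measurable_const[of 0], of 0] by simp
next
  case (insert j J)
  then have "T (\<lambda>y. c j * F j y + (\<Sum>j\<in>J. c j * F j y)) x
      = c j * T (F j) x + T (\<lambda>y. \<Sum>j\<in>J. c j * F j y) x"
    by (intro lincomb bounded_measurable_sum) auto
  with insert show ?case by simp
qed

text \<open>The sign is written \<open>(- 1) ^ (k + j)\<close> rather than \<open>(- 1) ^ (k - j)\<close> to avoid truncated
  subtraction.\<close>

lemma generator_pow: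
  assumes f: "f \<in> bounded_measurable S" and x: "x \<in> space S"
  shows "((\<lambda>g y. r * (T g y - g y)) ^^ k) f x
    = r ^ k * (\<Sum>j\<le>k. real (k choose j) * (- 1) ^ (k + j) * (T ^^ j) f x)"
    (is "?A k f x = _")
proof -
  define G where "G k x = r ^ k * (\<Sum>j\<le>k. real (k choose j) * (- 1) ^ (k + j) * (T ^^ j) f x)" for k x
  have G': "G k = (\<lambda>x. \<Sum>j\<le>k. (r ^ k * (real (k choose j) * (- 1) ^ (k + j))) * (T ^^ j) f x)" for k
    by (simp add: G_def sum_distrib_left mult.assoc fun_eq_iff)
  have G: "G k \<in> bounded_measurable S" for k
    unfolding G' by (intro bounded_measurable_sum pow_closed f)
  have TG: "T (G k) x = r ^ k * (\<Sum>j\<le>k. real (k choose j) * (- 1) ^ (k + j) * (T ^^ Suc j) f x)"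
    if "x \<in> space S" for k x
    unfolding G' using that f by (subst sum) (auto simp: pow_closed sum_distrib_left mult.assoc)
  have A: "?A k f \<in> bounded_measurable S" for k
  proof (induction k)
    case (Suc k)
    have "(\<lambda>y. r * T (?A k f) y + (- r * ?A k f y + 0)) \<in> bounded_measurable S"
      using Suc by (intro bounded_measurable_lincomb closed bounded_measurable_const)
    then show ?case by (simp add: right_diff_distrib)
  qed (simp add: f)
  have "?A k f x = G k x"
    using x
  proof (induction k arbitrary: x)
    case 0
    then show ?case by (simp add: G_def)
  next
    case (Suc k)
    let ?a = "\<lambda>j. (T ^^ j) f x"
    \<comment> \<open>Pascal's rule, after splitting off the term at 0. The two halves become
      \<open>T (G k)\<close> and \<open>G k\<close> up to the factor \<open>r ^ k\<close>.\<close>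
    have "(\<Sum>j\<le>Suc k. real (Suc k choose j) * (- 1) ^ (Suc k + j) * ?a j)
        = (- 1) ^ Suc k * ?a 0
          + (\<Sum>j\<le>k. (real (k choose j) + real (k choose Suc j)) * (- 1) ^ (k + j) * ?a (Suc j))"
      by (subst sum.atMost_Suc_shift) simp
    also have "\<dots> = (\<Sum>j\<le>k. real (k choose j) * (- 1) ^ (k + j) * ?a (Suc j))
        - ((- 1) ^ k * ?a 0 + (\<Sum>j\<le>k. real (k choose Suc j) * (- 1) ^ (k + Suc j) * ?a (Suc j)))"
      by (simp add: distrib_right sum.distrib sum_negf)
    also have "(- 1) ^ k * ?a 0 + (\<Sum>j\<le>k. real (k choose Suc j) * (- 1) ^ (k + Suc j) * ?a (Suc j))
        = (\<Sum>j\<le>Suc k. real (k choose j) * (- 1) ^ (k + j) * ?a j)"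
      by (subst sum.atMost_Suc_shift) simp
    \<comment> \<open>The term at \<open>Suc k\<close> drops out because
      \<open>k choose Suc k = 0\<close>.\<close>
    also have "\<dots> = (\<Sum>j\<le>k. real (k choose j) * (- 1) ^ (k + j) * ?a j)"
      by simp
    finally have "G (Suc k) x = r * (T (G k) x - G k x)"
      using Suc.prems by (simp add: TG G_def right_diff_distrib mult.assoc)
    \<comment> \<open>The induction hypothesis equates the two functions only on
      \<open>space S\<close>, so \<open>cong\<close> is needed under \<open>T\<close>.\<close>
    moreover have "T (?A k f) x = T (G k) x"
      using Suc A G by (intro cong) auto
    ultimately show ?case using Suc by simp
  qed
  then show ?thesis by (simp add: G_def)
qed

text \<open>This is \<open>exp (s (T - I)) = exp (- s) exp (s T)\<close> for
  \<open>s = t * r\<close>. The Cauchy product of the two scalar series at \<open>x\<close> has as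
  its coefficients the binomial expansions of \<open>generator_pow\<close>; absolute convergence
  comes from the contraction bound on the powers of \<open>T\<close>.\<close>

lemma op_exp_eq_poisson_average:
  assumes f: "f \<in> bounded_measurable S" and x: "x \<in> space S"
  shows "op_exp (\<lambda>g y. r * (T g y - g y)) t f x
    = (\<Sum>k. poisson_weight (t * r) k * (T ^^ k) f x)"
proof -
  define s where "s = t * r"
  let ?a = "\<lambda>j. (T ^^ j) f x"
  obtain c where c: "\<And>y. y \<in> space S \<Longrightarrow> \<bar>f y\<bar> \<le> c" using bounded_measurableE[OF f] by metis
  have ac: "\<bar>?a j\<bar> \<le> c" for j using pow_contraction[OF f c x] .
  have s1: "summable (\<lambda>k. norm (s ^ k / fact k * ?a k))"
  proof (rule summable_comparison_test'[where N = 0])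
    show "summable (\<lambda>k. norm (s ^ k) / fact k * c)"
      using summable_norm_exp[of s] by (intro summable_mult2) (simp add: divide_inverse mult.commute abs_mult)
    show "norm (norm (s ^ k / fact k * ?a k)) \<le> norm (s ^ k) / fact k * c" for k
      using mult_left_mono[OF ac[of k], of "\<bar>s\<bar> ^ k / fact k"] by (simp add: abs_mult power_abs)
  qed
  have s2: "summable (\<lambda>k. norm ((- s) ^ k / fact k))"
    using summable_norm_exp[of "- s"] by (simp only: real_scaleR_def divide_inverse mult.commute)
  have "(\<Sum>i\<le>k. (s ^ i / fact i * ?a i) * ((- s) ^ (k - i) / fact (k - i)))
      = t ^ k / fact k * ((\<lambda>g y. r * (T g y - g y)) ^^ k) f x" for k
  proof -
    have "(s ^ i / fact i * ?a i) * ((- s) ^ (k - i) / fact (k - i))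
        = t ^ k / fact k * (r ^ k * (real (k choose i) * (- 1) ^ (k + i) * ?a i))" if ik: "i \<le> k" for i
    proof -
      obtain d where d: "k = i + d" using le_Suc_ex[OF ik] by blast
      have "(s ^ i / fact i * ?a i) * ((- s) ^ d / fact d)
          = (s ^ i * s ^ d) * ((- 1) ^ d * (?a i / (fact i * fact d)))"
        by (simp add: power_minus[of s d])
      also have "s ^ i * s ^ d = t ^ k * r ^ k"
        by (simp add: s_def d power_mult_distrib power_add)
      \<comment> \<open>The exponents have equal parity: \<open>k + i = d + 2 * i\<close>.\<close>
      also have "(- 1) ^ d = ((- 1) ^ (k + i) :: real)"
        by (simp add: d power_add mult_ac)
      also have "?a i / (fact i * fact d) = real (k choose i) * ?a i / fact k"
        by (simp add: d binomial_fact)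
      finally show ?thesis by (simp add: d mult_ac)
    qed
    then show ?thesis
      by (simp add: generator_pow[OF f x] sum_distrib_left)
  qed
  then have "(\<lambda>k. t ^ k / fact k * ((\<lambda>g y. r * (T g y - g y)) ^^ k) f x) sums
      ((\<Sum>k. s ^ k / fact k * ?a k) * (\<Sum>k. (- s) ^ k / fact k))"
    using Cauchy_product_sums[OF s1 s2] by simp
  moreover have "(\<Sum>k. (- s) ^ k / fact k) = exp (- s)"
    by (simp add: exp_def divide_inverse mult.commute)
  moreover have "(\<Sum>k. s ^ k / fact k * ?a k) * exp (- s) = (\<Sum>k. poisson_weight s k * ?a k)"
    unfolding suminf_mult2[OF summable_norm_cancel[OF s1]] by (simp add: poisson_weight_def mult_ac)
  ultimately show ?thesis
    by (simp add: op_exp_def s_def sums_iff)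
qed

text \<open>Sum and integral may be exchanged because the powers of \<open>T\<close> are bounded
  uniformly in \<open>k\<close> and the weights are summable.\<close>

lemma integral_op_exp:
  assumes \<mu>: "prob_space \<mu>" "sets \<mu> = sets S" and f: "f \<in> bounded_measurable S"
    and t: "t \<ge> 0" and r: "r \<ge> 0"
  shows "(\<integral>x. op_exp (\<lambda>g y. r * (T g y - g y)) t f x \<partial>\<mu>)
    = (\<Sum>k. poisson_weight (t * r) k * (\<integral>x. (T ^^ k) f x \<partial>\<mu>))"
proof -
  have sp: "space \<mu> = space S" using \<mu>(2) by (rule sets_eq_imp_space_eq)
  obtain c where c: "\<And>y. y \<in> space S \<Longrightarrow> \<bar>f y\<bar> \<le> c" using bounded_measurableE[OF f] by metis
  have int: "integrable \<mu> ((T ^^ k) f)" for k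
    by (rule integrable_bounded_measurable[OF \<mu> pow_closed[OF f]])
  have tr: "t * r \<ge> 0" using t r by simp
  have "(\<integral>x. op_exp (\<lambda>g y. r * (T g y - g y)) t f x \<partial>\<mu>)
      = (\<integral>x. (\<Sum>k. poisson_weight (t * r) k * (T ^^ k) f x) \<partial>\<mu>)"
    by (intro Bochner_Integration.integral_cong op_exp_eq_poisson_average f) (auto simp: sp)
  also have "\<dots> = (\<Sum>k. \<integral>x. poisson_weight (t * r) k * (T ^^ k) f x \<partial>\<mu>)"
  proof (rule integral_suminf)
    show "integrable \<mu> (\<lambda>x. poisson_weight (t * r) k * (T ^^ k) f x)" for k
      using int by simp
    have n: "norm (poisson_weight (t * r) k * (T ^^ k) f x) = poisson_weight (t * r) k * \<bar>(T ^^ k) f x\<bar>"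
      for k x
      using poisson_weight_nonneg[OF tr] by (simp add: abs_mult)
    show "AE x in \<mu>. summable (\<lambda>k. norm (poisson_weight (t * r) k * (T ^^ k) f x))"
      unfolding n using pow_contraction[OF f c]
      by (intro AE_I2 summable_poisson_weight_mult[OF tr, where M = c]) (simp add: sp)
    have "summable (\<lambda>k. poisson_weight (t * r) k * (\<integral>x. \<bar>(T ^^ k) f x\<bar> \<partial>\<mu>))"
      using pow_contraction[OF f c]
      by (intro summable_poisson_weight_mult[OF tr, where M = c] integral_le_bound \<mu>) (simp add: sp)
    then show "summable (\<lambda>k. \<integral>x. norm (poisson_weight (t * r) k * (T ^^ k) f x) \<partial>\<mu>)"
      unfolding n by simp
  qed
  finally show ?thesis by simp
qed

text \<open>Invariance under \<open>T\<close> passes to all powers and hence to their Poisson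
  averages. Conversely, the integral of the exponential is \<open>exp (- s)\<close> times a power
  series in \<open>s = t * r\<close>; if it is constant, comparing linear coefficients gives
  invariance under \<open>T\<close>.\<close>

lemma invariant_op_exp_iff:
  assumes \<mu>: "prob_space \<mu>" "sets \<mu> = sets S" and r: "r > 0"
  shows "(\<forall>t\<ge>0. \<forall>f\<in>bounded_measurable S.
      (\<integral>x. op_exp (\<lambda>g y. r * (T g y - g y)) t f x \<partial>\<mu>) = (\<integral>x. f x \<partial>\<mu>))
    \<longleftrightarrow> (\<forall>f\<in>bounded_measurable S. (\<integral>x. T f x \<partial>\<mu>) = (\<integral>x. f x \<partial>\<mu>))"
    (is "?L \<longleftrightarrow> ?R")
proof
  assume R: ?R
  show ?L
  proof (intro allI impI ballI)
    fix t :: real and f assume t: "0 \<le> t" and f: "f \<in> bounded_measurable S"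
    have "(\<integral>x. (T ^^ k) f x \<partial>\<mu>) = (\<integral>x. f x \<partial>\<mu>)" for k
    proof (induction k)
      case (Suc k)
      then show ?case using bspec[OF R pow_closed[OF f, of k]] by simp
    qed simp
    then show "(\<integral>x. op_exp (\<lambda>g y. r * (T g y - g y)) t f x \<partial>\<mu>) = (\<integral>x. f x \<partial>\<mu>)"
      using integral_op_exp[OF \<mu> f t less_imp_le[OF r]]
        sums_unique[OF sums_mult2[OF poisson_weight_sums, of "t * r" "\<integral>x. f x \<partial>\<mu>"], symmetric]
      by simp
  qed
next
  assume L: ?L
  show ?R
  proof
    fix f assume f: "f \<in> bounded_measurable S"
    have sp: "space \<mu> = space S" using \<mu>(2) by (rule sets_eq_imp_space_eq)
    obtain M where M: "0 \<le> M" "\<And>y. y \<in> space S \<Longrightarrow> \<bar>f y\<bar> \<le> M"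
      using bounded_measurableE[OF f] by metis
    define a where "a k = (\<integral>x. (T ^^ k) f x \<partial>\<mu>)" for k
    have aM: "\<bar>a k\<bar> \<le> M" for k
      unfolding a_def using \<mu>(1) pow_contraction[OF f M(2)] by (intro integral_le_bound) (auto simp: sp)
    \<comment> \<open>Coefficients of \<open>exp s\<close> times the Poisson average of
      \<open>a k - a 0\<close>. The goal is \<open>c 1 = 0\<close>, since \<open>a 1\<close> and
      \<open>a 0\<close> are the integrals of \<open>T f\<close> and \<open>f\<close>.\<close>
    define c where "c k = (a k - a 0) / fact k" for k
    \<comment> \<open>This power series vanishes for \<open>s \<ge> 0\<close>, so its linear coefficient \<open>c 1\<close> is 0.\<close>
    have c: "(\<lambda>k. c k * s ^ k) sums 0" if "s \<ge> 0" for s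
    proof -
      have "(\<Sum>k. poisson_weight s k * a k) = a 0"
        using integral_op_exp[OF \<mu> f _ less_imp_le[OF r], of "s / r"]
          L[rule_format, OF _ f, of "s / r"] that r
        by (simp add: a_def)
      moreover have "summable (\<lambda>k. poisson_weight s k * a k)"
        using that aM by (rule summable_poisson_weight_mult)
      ultimately have "(\<lambda>k. poisson_weight s k * a k) sums a 0"
        using summable_sums by metis
      from sums_diff[OF this sums_mult2[OF poisson_weight_sums, of s "a 0"]]
      have "(\<lambda>k. exp s * (poisson_weight s k * a k - poisson_weight s k * a 0)) sums (exp s * 0)"
        by (intro sums_mult) simp
      moreover have "exp s * (poisson_weight s k * a k - poisson_weight s k * a 0) = c k * s ^ k" for k
        by (simp add: c_def poisson_weight_def exp_minus field_simps)
      ultimately show ?thesis by simp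
    qed
    \<comment> \<open>As \<open>c 0 = 0\<close>, the vanishing series equals \<open>s * E s\<close>.
      So \<open>E\<close> is zero for positive \<open>s\<close>, while its limit at 0 is its
      constant term \<open>c 1\<close>.\<close>
    define E where "E s = (\<Sum>k. c (Suc k) * s ^ k)" for s
    have E: "(\<lambda>k. c (Suc k) * s ^ k) sums E s" for s
      unfolding E_def
    proof (rule summable_sums, rule summable_comparison_test'[where N = 0])
      show "summable (\<lambda>k. 2 * M * (inverse (fact k) * \<bar>s\<bar> ^ k))"
        using summable_exp[of "\<bar>s\<bar>"] by (rule summable_mult)
      fix k
      have "\<bar>a (Suc k) - a 0\<bar> / fact (Suc k) \<le> 2 * M / fact k"
      proof (rule frac_le)
        show "\<bar>a (Suc k) - a 0\<bar> \<le> 2 * M" using aM[of "Suc k"] aM[of 0] by linarith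
        show "fact k \<le> (fact (Suc k) :: real)" by (rule fact_mono) simp
      qed (use M(1) in auto)
      then have "\<bar>a (Suc k) - a 0\<bar> / fact (Suc k) * \<bar>s\<bar> ^ k \<le> 2 * M / fact k * \<bar>s\<bar> ^ k"
        by (rule mult_right_mono) simp
      moreover have "norm (c (Suc k) * s ^ k) = \<bar>a (Suc k) - a 0\<bar> / fact (Suc k) * \<bar>s\<bar> ^ k"
        by (simp only: c_def real_norm_def abs_mult abs_divide power_abs)
           (simp add: abs_of_nonneg)
      ultimately show "norm (c (Suc k) * s ^ k) \<le> 2 * M * (inverse (fact k) * \<bar>s\<bar> ^ k)"
        by (simp only: divide_inverse mult.assoc)
    qed
    have "(E \<longlongrightarrow> c 1) (at_right 0)"
      using powser_limit_0[of 1 "\<lambda>k. c (Suc k)" E] E by (auto intro: tendsto_within_subset)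
    moreover have "E s = 0" if "s > 0" for s
    proof -
      have "(\<lambda>k. s * (c (Suc k) * s ^ k)) sums (s * E s)"
        by (intro sums_mult E)
      then have "(\<lambda>k. c (Suc k) * s ^ Suc k) sums (s * E s)"
        by (simp add: mult_ac)
      from sums_Suc[OF this] have "(\<lambda>k. c k * s ^ k) sums (s * E s)"
        by (simp add: c_def)
      then have "s * E s = 0" using c[of s] that sums_unique2 by force
      then show ?thesis using that by simp
    qed
    then have "(E \<longlongrightarrow> 0) (at_right 0)"
      by (intro tendsto_eventually eventually_at_right_less[THEN eventually_mono]) auto
    ultimately have "c 1 = 0"
      by (intro tendsto_unique[of "at_right (0::real)"]) auto
    then show "(\<integral>x. T f x \<partial>\<mu>) = (\<integral>x. f x \<partial>\<mu>)"
      by (simp add: c_def a_def)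
  qed
qed

end

section \<open>Markov processes and stationary measures\<close>

lemma indicator_bounded_measurable: "A \<in> sets S \<Longrightarrow> indicator A \<in> bounded_measurable S"
  by (rule bounded_measurableI[where c = 1]) auto

lemma markov_processD:
  assumes "markov_process S Y" "x \<in> space S"
  shows prob_space_pr: "prob_space (pr Y x)"
    and AE_state_0: "AE w in pr Y x. state Y 0 w = x"
    and measurable_state: "t \<ge> 0 \<Longrightarrow> state Y t \<in> measurable (pr Y x) S"
  using assms by (auto simp: markov_process_def)

lemma measurable_law:
  "markov_process S Y \<Longrightarrow> t \<ge> 0 \<Longrightarrow> law S Y t \<in> measurable S (prob_algebra S)"
  by (auto simp: markov_process_def)

lemma
  assumes "markov_process S Y" "x \<in> space S" "t \<ge> 0"
  shows prob_space_law: "prob_space (law S Y t x)"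
    and sets_law: "sets (law S Y t x) = sets S"
    and space_law: "space (law S Y t x) = space S"
  using measurable_space[OF measurable_law[OF assms(1,3)] assms(2)]
  by (auto simp: space_prob_algebra dest: sets_eq_imp_space_eq)

lemma transition_op_eq_integral_law:
  assumes "markov_process S Y" "x \<in> space S" "t \<ge> 0" "f \<in> borel_measurable S"
  shows "transition_op Y t f x = (\<integral>y. f y \<partial>law S Y t x)"
  unfolding law_def transition_op_def
  by (rule integral_distr[OF measurable_state[OF assms(1-3)] assms(4), symmetric])

lemma transition_op_0:
  assumes "markov_process S Y" "x \<in> space S" "f \<in> borel_measurable S"
  shows "transition_op Y 0 f x = f x"
proof -
  interpret prob_space "pr Y x" using assms by (intro prob_space_pr)
  have [measurable]: "state Y 0 \<in> measurable (pr Y x) S"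
    by (rule measurable_state[OF assms(1,2)]) simp
  note assms(3)[measurable]
  have "transition_op Y 0 f x = (\<integral>w. f x \<partial>pr Y x)"
    unfolding transition_op_def
  proof (rule integral_cong_AE)
    show "AE w in pr Y x. f (state Y 0 w) = f x"
      using AE_state_0[OF assms(1,2)] by eventually_elim simp
  qed measurable
  then show ?thesis by (simp add: prob_space)
qed

lemma markov_operator_transition_op:
  assumes Y: "markov_process S Y" and t: "t \<ge> 0"
  shows "markov_operator S (transition_op Y t)"
proof
  note law = prob_space_law[OF Y _ t] sets_law[OF Y _ t] space_law[OF Y _ t]
  show bound: "\<bar>transition_op Y t f x\<bar> \<le> b"
    if "f \<in> bounded_measurable S" "\<And>y. y \<in> space S \<Longrightarrow> \<bar>f y\<bar> \<le> b" "x \<in> space S" for f b x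
    using that law
    by (subst transition_op_eq_integral_law[OF Y _ t])
       (auto intro!: integral_le_bound bounded_measurableD)
  show "transition_op Y t f \<in> bounded_measurable S" if f: "f \<in> bounded_measurable S" for f
  proof -
    obtain c where "\<And>y. y \<in> space S \<Longrightarrow> \<bar>f y\<bar> \<le> c" using bounded_measurableE[OF f] by metis
    moreover have "(\<lambda>x. \<integral>y. f y \<partial>law S Y t x) \<in> borel_measurable S"
      using measurable_compose[OF measurable_prob_algebraD[OF measurable_law[OF Y t]]
          integral_measurable_subprob_algebra[OF bounded_measurableD[OF f]]] .
    then have "transition_op Y t f \<in> borel_measurable S"
      using transition_op_eq_integral_law[OF Y _ t bounded_measurableD[OF f]]
      by (simp cong: measurable_cong)
    ultimately show ?thesis using bound[OF f] by (intro bounded_measurableI) auto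
  qed
  show "transition_op Y t (\<lambda>y. c * f y + g y) x = c * transition_op Y t f x + transition_op Y t g x"
    if "f \<in> bounded_measurable S" "g \<in> bounded_measurable S" "x \<in> space S" for f g c x
    using that integrable_bounded_measurable[OF law(1,2)]
    by (simp add: transition_op_eq_integral_law[OF Y _ t] bounded_measurableD bounded_measurable_lincomb)
qed

section \<open>Composition of kernels and the Chapman-Kolmogorov equation\<close>

lemma integral_bind_bounded:
  assumes \<mu>: "prob_space \<mu>" "sets \<mu> = sets S" and K: "K \<in> measurable S (prob_algebra S)"
    and f: "f \<in> bounded_measurable S"
  shows "(\<integral>x. f x \<partial>(\<mu> \<bind> K)) = (\<integral>x. (\<integral>y. f y \<partial>K x) \<partial>\<mu>)"
proof -
  have sp: "space \<mu> = space S" using \<mu>(2) by (rule sets_eq_imp_space_eq)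
  obtain c where c: "\<And>y. y \<in> space S \<Longrightarrow> \<bar>f y\<bar> \<le> c" using bounded_measurableE[OF f] by metis
  have \<mu>': "\<mu> \<in> space (prob_algebra S)" using \<mu> by (simp add: space_prob_algebra)
  have B: "prob_space (\<mu> \<bind> K)" "sets (\<mu> \<bind> K) = sets S"
    using prob_space_bind'[OF \<mu>' K] sets_bind'[OF \<mu>' K] by auto
  have Kx: "prob_space (K x)" "sets (K x) = sets S" if "x \<in> space S" for x
    using measurable_space[OF K that] by (auto simp: space_prob_algebra)
  have Ks: "K \<in> measurable \<mu> (subprob_algebra S)"
    using measurable_prob_algebraD[OF K] by (simp cong: measurable_cong_sets add: \<mu>(2))
  \<comment> \<open>Shifting \<open>f\<close> to a nonnegative function reduces to the nonnegative Lebesgue integral.\<close>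
  define g where "g y = c + f y" for y
  have g: "g \<in> bounded_measurable S"
    unfolding g_def using bounded_measurable_lincomb[OF bounded_measurable_const f, of 1 c] by simp
  have g0: "0 \<le> g y" if "y \<in> space S" for y
    using c[OF that] by (simp add: g_def)
  have gB: "(\<integral>y. g y \<partial>M) = c + (\<integral>y. f y \<partial>M)" if "prob_space M" "sets M = sets S" for M
  proof -
    interpret prob_space M by fact
    show ?thesis
      using integrable_bounded_measurable[OF that f] by (simp add: g_def prob_space)
  qed
  have nn: "(\<integral>\<^sup>+y. ennreal (g y) \<partial>M) = ennreal (\<integral>y. g y \<partial>M)" if "prob_space M" "sets M = sets S" for M
    using that g g0
    by (intro nn_integral_eq_integral integrable_bounded_measurable AE_I2)
       (auto dest: sets_eq_imp_space_eq)
  have Kg: "(\<lambda>x. \<integral>y. g y \<partial>K x) \<in> borel_measurable \<mu>"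
    using measurable_compose[OF Ks integral_measurable_subprob_algebra[OF bounded_measurableD[OF g]]] .
  have Kg0: "0 \<le> (\<integral>y. g y \<partial>K x)" if "x \<in> space S" for x
    using g0 Kx(2)[OF that] by (intro integral_nonneg_AE AE_I2) (auto dest: sets_eq_imp_space_eq)
  have "(\<integral>y. g y \<partial>(\<mu> \<bind> K)) = enn2real (\<integral>\<^sup>+y. ennreal (g y) \<partial>(\<mu> \<bind> K))"
    using g g0 B(2)
    by (intro integral_eq_nn_integral AE_I2)
       (auto dest: sets_eq_imp_space_eq bounded_measurableD cong: measurable_cong_sets)
  also have "(\<integral>\<^sup>+y. ennreal (g y) \<partial>(\<mu> \<bind> K)) = (\<integral>\<^sup>+x. \<integral>\<^sup>+y. ennreal (g y) \<partial>K x \<partial>\<mu>)"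
    using g Ks by (intro nn_integral_bind[where B = S]) (auto dest: bounded_measurableD)
  also have "\<dots> = (\<integral>\<^sup>+x. ennreal (\<integral>y. g y \<partial>K x) \<partial>\<mu>)"
    using nn Kx by (intro nn_integral_cong) (auto simp: sp)
  also have "enn2real \<dots> = (\<integral>x. (\<integral>y. g y \<partial>K x) \<partial>\<mu>)"
    using Kg Kg0 by (intro integral_eq_nn_integral[symmetric] AE_I2) (auto simp: sp)
  also have "\<dots> = (\<integral>x. c + (\<integral>y. f y \<partial>K x) \<partial>\<mu>)"
    using gB Kx by (intro Bochner_Integration.integral_cong) (auto simp: sp)
  also have "\<dots> = c + (\<integral>x. (\<integral>y. f y \<partial>K x) \<partial>\<mu>)"
  proof -
    interpret prob_space \<mu> by fact
    have "integrable \<mu> (\<lambda>x. \<integral>y. f y \<partial>K x)"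
    proof (rule integrable_const_bound[where B = c])
      show "AE x in \<mu>. norm (\<integral>y. f y \<partial>K x) \<le> c"
        using c Kx by (intro AE_I2) (auto simp: sp sets_eq_imp_space_eq[OF Kx(2)] intro!: integral_le_bound)
      show "(\<lambda>x. \<integral>y. f y \<partial>K x) \<in> borel_measurable \<mu>"
        using measurable_compose[OF Ks integral_measurable_subprob_algebra[OF bounded_measurableD[OF f]]] .
    qed
    then show ?thesis by (simp add: prob_space)
  qed
  finally show ?thesis using gB[OF B] by simp
qed

text \<open>Chapman-Kolmogorov, obtained by taking the mean of both sides of the Markov property.
  The assumption \<open>s + t \<ge> 0\<close> is separate because the sort of the time type does not
  link order and addition.\<close>

lemma law_add:
  assumes Y: "markov_process S Y" and x: "x \<in> space S" and st: "s \<ge> 0" "t \<ge> 0" "s + t \<ge> 0"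
  shows "law S Y (s + t) x = law S Y s x \<bind> law S Y t"
proof (rule measure_eqI)
  note law = prob_space_law[OF Y x] sets_law[OF Y x]
  have B: "law S Y s x \<in> space (prob_algebra S)"
    using law[OF st(1)] by (simp add: space_prob_algebra)
  have Bs: "sets (law S Y s x \<bind> law S Y t) = sets S" and Bp: "prob_space (law S Y s x \<bind> law S Y t)"
    using sets_bind'[OF B measurable_law[OF Y st(2)]] prob_space_bind'[OF B measurable_law[OF Y st(2)]]
    by auto
  show "sets (law S Y (s + t) x) = sets (law S Y s x \<bind> law S Y t)"
    using law(2)[OF st(3)] Bs by simp
  fix A assume "A \<in> sets (law S Y (s + t) x)"
  then have A: "A \<in> sets S" using law(2)[OF st(3)] by simp
  define P where "P = pr Y x"
  interpret P: prob_space P unfolding P_def using prob_space_pr[OF Y x] .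
  have state: "state Y u \<in> measurable P S" if "u \<ge> 0" for u
    unfolding P_def using measurable_state[OF Y x that] .
  have sub: "subalgebra P (past S Y x s)"
  proof -
    have "{state Y u -` A \<inter> space P | u A. 0 \<le> u \<and> u \<le> s \<and> A \<in> sets S} \<subseteq> sets P"
      using state by (auto intro: measurable_sets)
    then show ?thesis
      unfolding past_def subalgebra_def P_def[symmetric]
      by (auto intro!: sets.sigma_sets_subset simp: space_measure_of_conv sets_measure_of_conv)
  qed
  interpret sub: finite_measure_subalgebra P "past S Y x s"
    by unfold_locales (rule sub)
  define h where "h y = measure (law S Y t y) A" for y
  have h: "h \<in> bounded_measurable S"
  proof (rule bounded_measurableI)
    show "h \<in> borel_measurable S"
      unfolding h_def using measurable_compose[OF measurable_law[OF Y st(2)] measurable_measure_prob_algebra[OF A]] .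
    show "\<bar>h y\<bar> \<le> 1" if "y \<in> space S" for y
      using prob_space.prob_le_1[OF prob_space_law[OF Y that st(2)]] by (simp add: h_def)
  qed
  define i where "i w = (indicator A (state Y (s + t) w) :: real)" for w
  have i: "integrable P i"
  proof (rule P.integrable_const_bound[where B = 1])
    show "i \<in> borel_measurable P"
      unfolding i_def using state[OF st(3)] A by measurable
  qed (auto simp: i_def)
  have "measure (law S Y (s + t) x) A = (\<integral>y. indicator A y \<partial>law S Y (s + t) x)"
    using A law(2)[OF st(3)] by simp
  also have "\<dots> = (\<integral>w. i w \<partial>P)"
    unfolding law_def i_def P_def[symmetric] using A by (intro integral_distr state st) auto
  \<comment> \<open>Conditioning on the past, a subalgebra by \<open>sub\<close>, preserves the
    mean; the Markov property then identifies the conditional expectation with \<open>h\<close> at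
    the state at time \<open>s\<close>.\<close>
  also have "\<dots> = (\<integral>w. real_cond_exp P (past S Y x s) i w \<partial>P)"
    using sub.real_cond_exp_int(2)[OF i] by simp
  also have "\<dots> = (\<integral>w. h (state Y s w) \<partial>P)"
  proof (rule integral_cong_AE)
    show "AE w in P. real_cond_exp P (past S Y x s) i w = h (state Y s w)"
      using Y x st A unfolding markov_process_def i_def h_def P_def by blast
    show "(\<lambda>w. h (state Y s w)) \<in> borel_measurable P"
      using measurable_compose[OF state[OF st(1)] bounded_measurableD[OF h]] .
  qed simp
  also have "\<dots> = (\<integral>y. h y \<partial>law S Y s x)"
    unfolding law_def P_def[symmetric] using h
    by (intro integral_distr[symmetric] state st bounded_measurableD)
  also have "\<dots> = (\<integral>y. (\<integral>z. indicator A z \<partial>law S Y t y) \<partial>law S Y s x)"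
    by (intro Bochner_Integration.integral_cong refl) (simp add: h_def space_law[OF Y x st(1)] sets_law[OF Y _ st(2)] A prob_space.finite_measure[OF prob_space_law[OF Y _ st(2)]] )
  also have "\<dots> = (\<integral>z. indicator A z \<partial>(law S Y s x \<bind> law S Y t))"
    by (rule integral_bind_bounded[OF law[OF st(1)] measurable_law[OF Y st(2)], symmetric])
       (rule indicator_bounded_measurable[OF A])
  also have "\<dots> = measure (law S Y s x \<bind> law S Y t) A"
    using A Bs prob_space.finite_measure[OF Bp] by simp
  finally show "emeasure (law S Y (s + t) x) A = emeasure (law S Y s x \<bind> law S Y t) A"
    using finite_measure.emeasure_eq_measure[OF prob_space.finite_measure[OF Bp]]
      finite_measure.emeasure_eq_measure[OF prob_space.finite_measure[OF law(1)[OF st(3)]]]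
    by simp
qed

lemma transition_op_add:
  assumes Y: "markov_process S Y" and x: "x \<in> space S" and st: "s \<ge> 0" "t \<ge> 0" "s + t \<ge> 0"
    and f: "f \<in> bounded_measurable S"
  shows "transition_op Y (s + t) f x = transition_op Y s (transition_op Y t f) x"
proof -
  have "transition_op Y (s + t) f x = (\<integral>y. (\<integral>z. f z \<partial>law S Y t y) \<partial>law S Y s x)"
    using integral_bind_bounded[OF prob_space_law[OF Y x st(1)] sets_law[OF Y x st(1)]
        measurable_law[OF Y st(2)] f]
    by (simp add: transition_op_eq_integral_law[OF Y x st(3)] bounded_measurableD f law_add[OF Y x st])
  also have "\<dots> = (\<integral>y. transition_op Y t f y \<partial>law S Y s x)"
    by (intro Bochner_Integration.integral_cong refl)
       (simp add: space_law[OF Y x st(1)] transition_op_eq_integral_law[OF Y _ st(2)] bounded_measurableD f)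
  also have "\<dots> = transition_op Y s (transition_op Y t f) x"
    using markov_operator.closed[OF markov_operator_transition_op[OF Y st(2)] f]
    by (simp add: transition_op_eq_integral_law[OF Y x st(1)] bounded_measurableD)
  finally show ?thesis .
qed

text \<open>Links the law at time \<open>k\<close>, which enters the separation distance, to the
  powers of the one-step operator in the convergence hypothesis. The induction splits off the first
  step.\<close>

lemma transition_op_nat:
  fixes Y :: "(nat, 'w, 's) process"
  assumes Y: "markov_process S Y" and x: "x \<in> space S" and f: "f \<in> bounded_measurable S"
  shows "transition_op Y k f x = (transition_op Y 1 ^^ k) f x"
  using x
proof (induction k arbitrary: x)
  case 0
  then show ?case using transition_op_0[OF Y] f by (simp add: bounded_measurableD)
next
  case (Suc k)
  interpret markov_operator S "transition_op Y 1"
    by (rule markov_operator_transition_op[OF Y]) simp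
  have "transition_op Y (Suc k) f x = transition_op Y 1 (transition_op Y k f) x"
    using transition_op_add[OF Y Suc.prems, of 1 k f] f by simp
  also have "\<dots> = transition_op Y 1 ((transition_op Y 1 ^^ k) f) x"
    using Suc f markov_operator.closed[OF markov_operator_transition_op[OF Y, of k] f]
    by (intro cong pow_closed) auto
  finally show ?case by simp
qed

section \<open>Stationarity as invariance of integrals\<close>

text \<open>Integrals of indicators recover the measure. The operator form makes the chain and its
  continuous-time variant comparable.\<close>

lemma stationary_iff_invariant:
  assumes Y: "markov_process S Y"
  shows "stationary S Y \<mu> \<longleftrightarrow> prob_space \<mu> \<and> sets \<mu> = sets S \<and>
    (\<forall>t\<ge>0. \<forall>f\<in>bounded_measurable S. (\<integral>x. transition_op Y t f x \<partial>\<mu>) = (\<integral>x. f x \<partial>\<mu>))"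
proof -
  have "\<mu> \<bind> law S Y t = \<mu> \<longleftrightarrow>
      (\<forall>f\<in>bounded_measurable S. (\<integral>x. transition_op Y t f x \<partial>\<mu>) = (\<integral>x. f x \<partial>\<mu>))"
    if \<mu>: "prob_space \<mu>" "sets \<mu> = sets S" and t: "t \<ge> 0" for t
  proof -
    have sp: "space \<mu> = space S" using \<mu>(2) by (rule sets_eq_imp_space_eq)
    have B: "\<mu> \<in> space (prob_algebra S)"
      using \<mu> by (simp add: space_prob_algebra)
    have Bs: "sets (\<mu> \<bind> law S Y t) = sets S" and Bp: "prob_space (\<mu> \<bind> law S Y t)"
      using sets_bind'[OF B measurable_law[OF Y t]] prob_space_bind'[OF B measurable_law[OF Y t]] by auto
    have eq: "(\<integral>x. transition_op Y t f x \<partial>\<mu>) = (\<integral>x. f x \<partial>(\<mu> \<bind> law S Y t))"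
      if f: "f \<in> bounded_measurable S" for f
      unfolding integral_bind_bounded[OF \<mu> measurable_law[OF Y t] f]
      using f by (intro Bochner_Integration.integral_cong refl transition_op_eq_integral_law[OF Y _ t])
        (auto simp: sp bounded_measurableD)
    show ?thesis
    proof
      assume inv: "\<forall>f\<in>bounded_measurable S. (\<integral>x. transition_op Y t f x \<partial>\<mu>) = (\<integral>x. f x \<partial>\<mu>)"
      show "\<mu> \<bind> law S Y t = \<mu>"
      proof (rule measure_eqI)
        fix A assume "A \<in> sets (\<mu> \<bind> law S Y t)"
        then have A: "A \<in> sets S" by (simp add: Bs)
        from indicator_bounded_measurable[OF this] inv eq have "(\<integral>x. indicator A x \<partial>(\<mu> \<bind> law S Y t)) = (\<integral>x. indicator A x \<partial>\<mu> :: real)"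
          by metis
        then have "measure (\<mu> \<bind> law S Y t) A = measure \<mu> A"
          using A Bs \<mu>(2) prob_space.finite_measure[OF Bp] prob_space.finite_measure[OF \<mu>(1)] by simp
        then show "emeasure (\<mu> \<bind> law S Y t) A = emeasure \<mu> A"
          using finite_measure.emeasure_eq_measure[OF prob_space.finite_measure[OF Bp]]
            finite_measure.emeasure_eq_measure[OF prob_space.finite_measure[OF \<mu>(1)]]
          by simp
      qed (simp add: Bs \<mu>)
    qed (simp add: eq)
  qed
  then show ?thesis by (auto simp: stationary_def)
qed

lemma stationary_nat_iff:
  fixes Y :: "(nat, 'w, 's) process"
  assumes Y: "markov_process S Y"
  shows "stationary S Y \<mu> \<longleftrightarrow> prob_space \<mu> \<and> sets \<mu> = sets S \<and>
    (\<forall>f\<in>bounded_measurable S. (\<integral>x. transition_op Y 1 f x \<partial>\<mu>) = (\<integral>x. f x \<partial>\<mu>))"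
proof -
  interpret markov_operator S "transition_op Y 1"
    by (rule markov_operator_transition_op[OF Y]) simp
  have "(\<integral>x. transition_op Y k f x \<partial>\<mu>) = (\<integral>x. f x \<partial>\<mu>)"
    if "sets \<mu> = sets S" and f: "f \<in> bounded_measurable S"
      and inv: "\<forall>f\<in>bounded_measurable S. (\<integral>x. transition_op Y 1 f x \<partial>\<mu>) = (\<integral>x. f x \<partial>\<mu>)" for k f
  proof -
    have "(\<integral>x. (transition_op Y 1 ^^ k) f x \<partial>\<mu>) = (\<integral>x. f x \<partial>\<mu>)"
    proof (induction k)
      case (Suc k)
      then show ?case using bspec[OF inv pow_closed[OF f, of k]] by simp
    qed simp
    moreover have "(\<integral>x. transition_op Y k f x \<partial>\<mu>) = (\<integral>x. (transition_op Y 1 ^^ k) f x \<partial>\<mu>)"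
      using sets_eq_imp_space_eq[OF that(1)]
      by (intro Bochner_Integration.integral_cong refl transition_op_nat[OF Y _ f]) simp
    ultimately show ?thesis by simp
  qed
  then show ?thesis unfolding stationary_iff_invariant[OF Y] by auto
qed

text \<open>In operator form this is \<open>invariant_op_exp_iff\<close>. It makes the unique
  stationary measure of the chain also that of the variant, so both separation distances refer to
  the same measure.\<close>

lemma stationary_continuous_time_variant:
  assumes Y: "markov_process S Y" and Y': "continuous_time_variant S Y r Y'" and r: "r > 0"
  shows "stationary S Y' = stationary S Y"
proof
  fix \<mu>
  interpret markov_operator S "transition_op Y 1"
    by (rule markov_operator_transition_op[OF Y]) simp
  have mY': "markov_process S Y'" using Y' by (simp add: continuous_time_variant_def)
  have eq: "(\<integral>x. transition_op Y' t f x \<partial>\<mu>)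
      = (\<integral>x. op_exp (\<lambda>g y. r * (transition_op Y 1 g y - g y)) t f x \<partial>\<mu>)"
    if "sets \<mu> = sets S" "t \<ge> 0" "f \<in> bounded_measurable S" for t f
    using Y' that sets_eq_imp_space_eq[OF that(1)]
    by (intro Bochner_Integration.integral_cong refl)
       (simp add: continuous_time_variant_def bounded_measurable_def)
  show "stationary S Y' \<mu> = stationary S Y \<mu>"
    unfolding stationary_iff_invariant[OF mY'] stationary_nat_iff[OF Y]
    using eq invariant_op_exp_iff[of \<mu>, OF _ _ r] by auto
qed

section \<open>Separation distance\<close>

lemma space_borel_of: "space (borel_of Z) = topspace Z"
  unfolding borel_of_def by (rule space_measure_of) (auto dest: openin_subset)

lemma borel_of_euclidean: "borel_of euclidean = borel"
  by (simp add: borel_of_def borel_def)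

lemma continuous_map_borel_of:
  assumes "continuous_map Z W g"
  shows "g \<in> measurable (borel_of Z) (borel_of W)"
proof -
  have "sets (borel_of Z) = sigma_sets (topspace Z) {U. openin Z U}"
    unfolding borel_of_def by (rule sets_measure_of) (auto dest: openin_subset)
  then have "U \<in> sets (borel_of Z)" if "openin Z U" for U
    using that by (auto intro: sigma_sets.Basic)
  moreover have "g -` U \<inter> topspace Z = {x \<in> topspace Z. g x \<in> U}" for U
    by blast
  ultimately have "g -` U \<inter> topspace Z \<in> sets (borel_of Z)" if "openin W U" for U
    using openin_continuous_map_preimage[OF assms that] by simp
  then show ?thesis
    unfolding borel_of_def[of W] using continuous_map_funspace[OF assms]
    by (intro measurable_measure_of) (auto simp: space_borel_of dest: openin_subset)
qed

lemma continuous_map_bounded_measurable: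
  assumes "compact_space Z" "continuous_map Z euclideanreal f"
  shows "f \<in> bounded_measurable (borel_of Z)"
proof -
  have "compactin euclideanreal (f ` topspace Z)"
    using image_compactin assms unfolding compact_space_def by blast
  then have "bounded (f ` topspace Z)"
    by (auto intro: compact_imp_bounded)
  then show ?thesis
    using continuous_map_borel_of[OF assms(2)]
    by (simp add: bounded_measurable_def space_borel_of borel_of_euclidean)
qed

lemma abs_le_sup_norm:
  assumes "bounded (f ` S)" "x \<in> S"
  shows "\<bar>f x\<bar> \<le> sup_norm S f"
  unfolding sup_norm_def
proof (rule cSUP_upper[OF assms(2)])
  obtain B where "\<And>x. x \<in> S \<Longrightarrow> \<bar>f x\<bar> \<le> B"
    using assms(1) by (auto simp: bounded_iff)
  then show "bdd_above ((\<lambda>x. \<bar>f x\<bar>) ` S)" by (rule bdd_aboveI2)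
qed

lemma sup_norm_le: "S \<noteq> {} \<Longrightarrow> (\<And>x. x \<in> S \<Longrightarrow> \<bar>f x\<bar> \<le> c) \<Longrightarrow> sup_norm S f \<le> c"
  unfolding sup_norm_def by (rule cSUP_least)

section \<open>Separation distance as a double supremum\<close>

text \<open>A quotient of nonnegative integrals is nonnegative, also when the denominator is 0,
  since division by 0 yields 0. This supplies the upper bound that real suprema require.\<close>

lemma ratio_le_1:
  fixes f :: "'s \<Rightarrow> real"
  assumes "space P = topspace Z" "space Q = topspace Z" "\<And>z. z \<in> topspace Z \<Longrightarrow> 0 < f z"
  shows "1 - (\<integral>z. f z \<partial>P) / (\<integral>z. f z \<partial>Q) \<le> 1"
proof -
  have "0 \<le> (\<integral>z. f z \<partial>P)" "0 \<le> (\<integral>z. f z \<partial>Q)"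
    using assms by (auto intro!: integral_nonneg_AE AE_I2 intro: less_imp_le)
  then show ?thesis by simp
qed

lemma sep_ge:
  assumes "space P = topspace Z" "space Q = topspace Z"
    "continuous_map Z euclideanreal f" "\<And>z. z \<in> topspace Z \<Longrightarrow> 0 < f z"
  shows "1 - (\<integral>z. f z \<partial>P) / (\<integral>z. f z \<partial>Q) \<le> sep Z P Q"
  unfolding sep_def
proof (rule cSUP_upper)
  show "bdd_above ((\<lambda>f. 1 - (\<integral>z. f z \<partial>P) / (\<integral>z. f z \<partial>Q)) `
      {f. continuous_map Z euclideanreal f \<and> (\<forall>z\<in>topspace Z. 0 < f z)})"
    by (rule bdd_aboveI2[where M = 1]) (rule ratio_le_1[OF assms(1,2)], simp)
qed (use assms in simp)

lemma sep_le:
  assumes "\<And>f. continuous_map Z euclideanreal f \<Longrightarrow> (\<And>z. z \<in> topspace Z \<Longrightarrow> 0 < f z) \<Longrightarrow>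
      1 - (\<integral>z. f z \<partial>P) / (\<integral>z. f z \<partial>Q) \<le> L"
  shows "sep Z P Q \<le> L"
  unfolding sep_def
proof (rule cSUP_least)
  \<comment> \<open>The constant 1 shows that there are test functions at all; a real supremum over
    the empty set would be unspecified.\<close>
  have "(\<lambda>z. 1) \<in> {f. continuous_map Z euclideanreal f \<and> (\<forall>z\<in>topspace Z. 0 < f z)}" by simp
  then show "{f. continuous_map Z euclideanreal f \<and> (\<forall>z\<in>topspace Z. 0 < f z)} \<noteq> {}" by blast
qed (use assms in auto)

lemma the_unique_stationary:
  "unique_stationary S Y \<nu> \<Longrightarrow> (THE \<nu>. unique_stationary S Y \<nu>) = \<nu>"
  unfolding unique_stationary_def by (rule the_equality) blast+

lemma unique_stationaryD:
  assumes "unique_stationary S Y \<nu>"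
  shows "prob_space \<nu>" "sets \<nu> = sets S" "space \<nu> = space S" "space S \<noteq> {}"
proof -
  show *: "prob_space \<nu>" "sets \<nu> = sets S"
    using assms by (simp_all only: unique_stationary_def stationary_def)
  then show "space \<nu> = space S" by (auto dest: sets_eq_imp_space_eq)
  then show "space S \<noteq> {}" using prob_space.not_empty[OF *(1)] by simp
qed

text \<open>With \<open>separation_distance_le\<close>, this describes the separation distance as a
  supremum over initial states and test functions jointly, expressed through the transition
  operator.\<close>

lemma separation_distance_ge:
  assumes Y: "markov_process (borel_of Z) Y" and \<nu>: "unique_stationary (borel_of Z) Y \<nu>"
    and t: "t \<ge> 0" and x: "x \<in> topspace Z"
    and f: "continuous_map Z euclideanreal f" "\<And>z. z \<in> topspace Z \<Longrightarrow> 0 < f z"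
  shows "1 - transition_op Y t f x / (\<integral>z. f z \<partial>\<nu>) \<le> separation_distance Z Y t"
proof -
  let ?P = "\<lambda>x. law (borel_of Z) Y t x"
  have P: "space (?P x) = topspace Z" if "x \<in> topspace Z" for x
    using space_law[OF Y _ t] that by (simp add: space_borel_of)
  have Q: "space \<nu> = topspace Z"
    using unique_stationaryD(3)[OF \<nu>] by (simp add: space_borel_of)
  have "1 - transition_op Y t f x / (\<integral>z. f z \<partial>\<nu>) = 1 - (\<integral>z. f z \<partial>?P x) / (\<integral>z. f z \<partial>\<nu>)"
    using x continuous_map_borel_of[OF f(1)]
    by (subst transition_op_eq_integral_law[OF Y _ t]) (auto simp: space_borel_of borel_of_euclidean)
  also have "\<dots> \<le> sep Z (?P x) \<nu>"
    using sep_ge[OF P[OF x] Q f] .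
  also have "\<dots> \<le> separation_distance Z Y t"
    unfolding separation_distance_def the_unique_stationary[OF \<nu>]
  proof (rule cSUP_upper[OF x])
    show "bdd_above ((\<lambda>x. sep Z (?P x) \<nu>) ` topspace Z)"
      by (intro bdd_aboveI2[where M = 1] sep_le ratio_le_1[where Z = Z] P Q)
  qed
  finally show ?thesis .
qed

lemma separation_distance_le:
  assumes Y: "markov_process (borel_of Z) Y" and \<nu>: "unique_stationary (borel_of Z) Y \<nu>"
    and t: "t \<ge> 0"
    and L: "\<And>x f. \<lbrakk>x \<in> topspace Z; continuous_map Z euclideanreal f; \<And>z. z \<in> topspace Z \<Longrightarrow> 0 < f z\<rbrakk>
      \<Longrightarrow> 1 - transition_op Y t f x / (\<integral>z. f z \<partial>\<nu>) \<le> L"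
  shows "separation_distance Z Y t \<le> L"
  unfolding separation_distance_def the_unique_stationary[OF \<nu>]
proof (rule cSUP_least)
  \<comment> \<open>The stationary probability measure lives on this space, so there is an initial
    state.\<close>
  show "topspace Z \<noteq> {}" using unique_stationaryD(4)[OF \<nu>] by (simp add: space_borel_of)
  fix x assume x: "x \<in> topspace Z"
  show "sep Z (law (borel_of Z) Y t x) \<nu> \<le> L"
  proof (rule sep_le)
    fix f assume f: "continuous_map Z euclideanreal f" "\<And>z. z \<in> topspace Z \<Longrightarrow> 0 < f z"
    have "transition_op Y t f x = (\<integral>z. f z \<partial>law (borel_of Z) Y t x)"
      using x continuous_map_borel_of[OF f(1)]
      by (intro transition_op_eq_integral_law[OF Y _ t]) (auto simp: space_borel_of borel_of_euclidean)
    then show "1 - (\<integral>z. f z \<partial>law (borel_of Z) Y t x) / (\<integral>z. f z \<partial>\<nu>) \<le> L"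
      using L[OF x f] by simp
  qed
qed

section \<open>Passing to the limit in the lower bounds\<close>

lemma integral_pos:
  fixes f :: "'s \<Rightarrow> real"
  assumes \<mu>: "prob_space \<mu>" and f: "integrable \<mu> f" "\<And>x. x \<in> space \<mu> \<Longrightarrow> 0 < f x"
  shows "0 < (\<integral>x. f x \<partial>\<mu>)"
proof -
  interpret prob_space \<mu> by fact
  have "(\<integral>x. 0 \<partial>\<mu>) < (\<integral>x. f x \<partial>\<mu>)"
    using f by (intro integral_less_AE_space AE_I2) (simp_all add: emeasure_space_1)
  then show ?thesis by simp
qed

text \<open>The time type and the times \<open>\<tau> n\<close> are left open so that one argument
  serves both the chains at their rescaled integer times and the variants at \<open>t\<close>.
  Everything specific to either case is isolated in \<open>conv\<close>.\<close>

lemma separation_distance_le_liminf: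
  fixes E :: "'e metric" and Y :: "(real, 'w, 'e) process"
    and En :: "nat \<Rightarrow> 'a metric" and Zn :: "nat \<Rightarrow> ('t::{linorder,monoid_add}, 'u, 'a) process"
  assumes E: "compact_space (mtopology_of E)"
    and Y: "markov_process (borel_of (mtopology_of E)) Y"
    and Zn: "\<And>n. markov_process (borel_of (mtopology_of (En n))) (Zn n)"
    and \<gamma>: "\<And>n. continuous_map (mtopology_of (En n)) (mtopology_of E) (\<gamma> n)"
    and dense: "\<And>y. y \<in> mspace E \<Longrightarrow>
           \<exists>yn. (\<forall>n. yn n \<in> mspace (En n)) \<and> limitin (mtopology_of E) (\<lambda>n. \<gamma> n (yn n)) y sequentially"
    and \<nu>n: "\<And>n. unique_stationary (borel_of (mtopology_of (En n))) (Zn n) (\<nu>n n)"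
    and \<nu>: "unique_stationary (borel_of (mtopology_of E)) Y \<nu>"
    and weak: "weakly_converges (mtopology_of E) (\<lambda>n. distr (\<nu>n n) (borel_of (mtopology_of E)) (\<gamma> n)) \<nu>"
    and t: "t \<ge> 0" and \<tau>: "\<And>n. \<tau> n \<ge> 0"
    and conv: "\<And>f y yn. \<lbrakk>continuous_map (mtopology_of E) euclideanreal f; \<And>n. yn n \<in> mspace (En n);
        y \<in> mspace E; limitin (mtopology_of E) (\<lambda>n. \<gamma> n (yn n)) y sequentially\<rbrakk>
      \<Longrightarrow> (\<lambda>n. transition_op (Zn n) (\<tau> n) (f \<circ> \<gamma> n) (yn n)) \<longlonglongrightarrow> transition_op Y t f y"
  shows "ereal (separation_distance (mtopology_of E) Y t)
    \<le> liminf (\<lambda>n. ereal (separation_distance (mtopology_of (En n)) (Zn n) (\<tau> n)))"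
proof -
  define L where "L = liminf (\<lambda>n. ereal (separation_distance (mtopology_of (En n)) (Zn n) (\<tau> n)))"
  have le: "ereal (1 - transition_op Y t f y / (\<integral>z. f z \<partial>\<nu>)) \<le> L"
    if y: "y \<in> mspace E" and f: "continuous_map (mtopology_of E) euclideanreal f"
      and pos: "\<And>z. z \<in> mspace E \<Longrightarrow> 0 < f z" for y f
  proof -
    obtain yn where yn: "\<And>n. yn n \<in> mspace (En n)"
      and lim: "limitin (mtopology_of E) (\<lambda>n. \<gamma> n (yn n)) y sequentially"
      using dense[OF y] by blast
    define u where "u n = 1 - transition_op (Zn n) (\<tau> n) (f \<circ> \<gamma> n) (yn n) / (\<integral>z. (f \<circ> \<gamma> n) z \<partial>\<nu>n n)" for n
    have f': "f \<in> bounded_measurable (borel_of (mtopology_of E))"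
      by (rule continuous_map_bounded_measurable[OF E f])
    \<comment> \<open>A change of variables makes the denominators integrals against the image
      measures, where weak convergence applies.\<close>
    have "(\<integral>z. (f \<circ> \<gamma> n) z \<partial>\<nu>n n) = (\<integral>z. f z \<partial>distr (\<nu>n n) (borel_of (mtopology_of E)) (\<gamma> n))" for n
      using continuous_map_borel_of[OF \<gamma>, of n] unique_stationaryD(2)[OF \<nu>n, of n] bounded_measurableD[OF f']
      by (subst integral_distr) (auto simp: comp_def cong: measurable_cong_sets)
    then have "(\<lambda>n. \<integral>z. (f \<circ> \<gamma> n) z \<partial>\<nu>n n) \<longlonglongrightarrow> (\<integral>z. f z \<partial>\<nu>)"
      using weak f f' by (simp add: weakly_converges_def bounded_measurable_def space_borel_of)
    \<comment> \<open>Positivity of the limiting denominator allows the limit of the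
      quotients.\<close>
    moreover have "0 < (\<integral>z. f z \<partial>\<nu>)"
      using unique_stationaryD[OF \<nu>] pos f'
      by (intro integral_pos integrable_bounded_measurable) (auto simp: space_borel_of)
    ultimately have u: "u \<longlonglongrightarrow> 1 - transition_op Y t f y / (\<integral>z. f z \<partial>\<nu>)"
      unfolding u_def by (intro tendsto_intros conv[OF f yn y lim]) (auto simp: comp_def)
    have "u n \<le> separation_distance (mtopology_of (En n)) (Zn n) (\<tau> n)" for n
      unfolding u_def
    proof (rule separation_distance_ge[OF Zn \<nu>n \<tau>])
      show "continuous_map (mtopology_of (En n)) euclideanreal (f \<circ> \<gamma> n)"
        by (rule continuous_map_compose[OF \<gamma> f])
      show "0 < (f \<circ> \<gamma> n) z" if "z \<in> topspace (mtopology_of (En n))" for z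
        using that continuous_map_image_subset_topspace[OF \<gamma>, of n] by (auto intro: pos)
    qed (use yn in simp)
    then have "liminf (\<lambda>n. ereal (u n)) \<le> L"
      unfolding L_def by (intro Liminf_mono always_eventually) simp
    moreover have "liminf (\<lambda>n. ereal (u n)) = ereal (1 - transition_op Y t f y / (\<integral>z. f z \<partial>\<nu>))"
      using u by (intro lim_imp_Liminf) auto
    ultimately show ?thesis by simp
  qed
  obtain y where y: "y \<in> mspace E"
    using unique_stationaryD(4)[OF \<nu>] by (auto simp: space_borel_of)
  \<comment> \<open>A real \<open>L\<close> bounds the double supremum; the value minus infinity
    contradicts \<open>le\<close> for the test function 1 at \<open>y\<close>; plus infinity is
    trivial.\<close>
  have "ereal (separation_distance (mtopology_of E) Y t) \<le> L"
  proof (cases L)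
    case (real l)
    then show ?thesis using le by (auto intro!: separation_distance_le[OF Y \<nu> t])
  next
    case MInf
    then show ?thesis using le[OF y, of "\<lambda>_. 1"] by simp
  qed simp
  then show ?thesis by (simp add: L_def)
qed

section \<open>Convergence of the transition operators along converging initial states\<close>

text \<open>Gathers the assumptions on the dynamics; those on stationary measures and on the density
  of the images are kept apart. All indices are admissible here, including 0.\<close>

locale approximating_chains =
  fixes E :: "'e metric" and Y :: "(real, 'w, 'e) process"
    and En :: "nat \<Rightarrow> 'a metric" and Yn :: "nat \<Rightarrow> (nat, 'u, 'a) process"
    and \<gamma> :: "nat \<Rightarrow> 'a \<Rightarrow> 'e" and \<epsilon> :: "nat \<Rightarrow> real"
  assumes compact_E: "compact_space (mtopology_of E)"
    and feller: "feller_process (mtopology_of E) Y"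
    and compact_En: "\<And>n. compact_space (mtopology_of (En n))"
    and markov_Yn: "\<And>n. markov_process (borel_of (mtopology_of (En n))) (Yn n)"
    and continuous_\<gamma>: "\<And>n. continuous_map (mtopology_of (En n)) (mtopology_of E) (\<gamma> n)"
    and \<epsilon>_pos: "\<And>n. \<epsilon> n > 0" and \<epsilon>_tendsto: "\<epsilon> \<longlonglongrightarrow> 0"
    and uniform: "\<And>f t. continuous_map (mtopology_of E) euclideanreal f \<Longrightarrow> t \<ge> 0 \<Longrightarrow>
           (\<lambda>n. sup_norm (mspace (En n))
                  (\<lambda>x. (transition_op (Yn n) 1 ^^ nat \<lfloor>t / \<epsilon> n\<rfloor>) (f \<circ> \<gamma> n) x
                        - (transition_op Y t f \<circ> \<gamma> n) x)) \<longlonglongrightarrow> 0"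
begin

abbreviation T :: "nat \<Rightarrow> ('a \<Rightarrow> real) \<Rightarrow> 'a \<Rightarrow> real" where
  "T n \<equiv> transition_op (Yn n) 1"

abbreviation BE :: "'e measure" where "BE \<equiv> borel_of (mtopology_of E)"

abbreviation BEn :: "nat \<Rightarrow> 'a measure" where "BEn n \<equiv> borel_of (mtopology_of (En n))"

sublocale T: markov_operator "BEn n" "T n" for n
  by (rule markov_operator_transition_op[OF markov_Yn]) simp

lemma markov_Y: "markov_process BE Y"
  using feller by (simp add: feller_process_def)

lemma feller_continuous:
  "continuous_map (mtopology_of E) euclideanreal f \<Longrightarrow> t \<ge> 0
    \<Longrightarrow> continuous_map (mtopology_of E) euclideanreal (transition_op Y t f)"
  using feller by (simp add: feller_process_def)

lemma \<gamma>_mspace: "x \<in> mspace (En n) \<Longrightarrow> \<gamma> n x \<in> mspace E"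
  using continuous_map_image_subset_topspace[OF continuous_\<gamma>, of n] by auto

lemma compose_bounded_measurable:
  "continuous_map (mtopology_of E) euclideanreal f \<Longrightarrow> f \<circ> \<gamma> n \<in> bounded_measurable (BEn n)"
  by (rule continuous_map_bounded_measurable[OF compact_En continuous_map_compose[OF continuous_\<gamma>]])

text \<open>Boundedness of the difference is what makes \<open>sup_norm\<close> a genuine bound,
  real suprema of unbounded sets being unspecified.\<close>

lemma abs_diff_le_sup_norm:
  assumes "f \<in> bounded_measurable (BEn n)" "g \<in> bounded_measurable (BEn n)" "x \<in> mspace (En n)"
  shows "\<bar>f x - g x\<bar> \<le> sup_norm (mspace (En n)) (\<lambda>x. f x - g x)"
proof (rule abs_le_sup_norm)
  show "bounded ((\<lambda>x. f x - g x) ` mspace (En n))"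
    using bounded_measurable_lincomb[OF assms(2,1), of "- 1"]
    by (simp add: bounded_measurable_def space_borel_of)
qed fact

text \<open>The difference from \<open>transition_op Y t f (\<gamma> n (yn n))\<close> vanishes by
  the uniform hypothesis, and that value converges because the Feller property makes
  \<open>transition_op Y t f\<close> continuous.\<close>

lemma tendsto_pow_transition_op:
  assumes f: "continuous_map (mtopology_of E) euclideanreal f" and t: "t \<ge> 0"
    and yn: "\<And>n. yn n \<in> mspace (En n)"
    and lim: "limitin (mtopology_of E) (\<lambda>n. \<gamma> n (yn n)) y sequentially"
  shows "(\<lambda>n. (T n ^^ nat \<lfloor>t / \<epsilon> n\<rfloor>) (f \<circ> \<gamma> n) (yn n)) \<longlonglongrightarrow> transition_op Y t f y"
proof -
  let ?d = "\<lambda>n. (T n ^^ nat \<lfloor>t / \<epsilon> n\<rfloor>) (f \<circ> \<gamma> n) (yn n) - (transition_op Y t f \<circ> \<gamma> n) (yn n)"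
  have "\<bar>?d n\<bar> \<le> sup_norm (mspace (En n))
      (\<lambda>x. (T n ^^ nat \<lfloor>t / \<epsilon> n\<rfloor>) (f \<circ> \<gamma> n) x - (transition_op Y t f \<circ> \<gamma> n) x)" for n
    using f t yn
    by (intro abs_diff_le_sup_norm T.pow_closed compose_bounded_measurable feller_continuous)
  then have "?d \<longlonglongrightarrow> 0"
    by (intro Lim_null_comparison[OF _ uniform[OF f t]]) (simp add: always_eventually)
  moreover have "(\<lambda>n. (transition_op Y t f \<circ> \<gamma> n) (yn n)) \<longlonglongrightarrow> transition_op Y t f y"
    using continuous_map_limit[OF feller_continuous[OF f t] lim] by (simp add: o_def)
  ultimately show ?thesis
    using tendsto_add by fastforce
qed

lemma tendsto_transition_op:
  assumes f: "continuous_map (mtopology_of E) euclideanreal f" and t: "t \<ge> 0"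
    and yn: "\<And>n. yn n \<in> mspace (En n)"
    and lim: "limitin (mtopology_of E) (\<lambda>n. \<gamma> n (yn n)) y sequentially"
  shows "(\<lambda>n. transition_op (Yn n) (nat \<lfloor>t / \<epsilon> n\<rfloor>) (f \<circ> \<gamma> n) (yn n)) \<longlonglongrightarrow> transition_op Y t f y"
  using tendsto_pow_transition_op[OF assms] yn
  by (simp add: transition_op_nat[OF markov_Yn _ compose_bounded_measurable[OF f]] space_borel_of)

text \<open>Triangle inequality through the limit semigroup: strong continuity makes
  \<open>transition_op Y s f\<close> close to \<open>f\<close> for small \<open>s\<close>, and the
  convergence hypothesis handles the rest for large \<open>n\<close>. One \<open>\<delta>\<close>
  serves all \<open>s\<close>, but the threshold for \<open>n\<close> depends on \<open>s\<close>,
  as \<open>poisson_average_tendsto\<close> permits.\<close>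

lemma small_increments:
  assumes f: "continuous_map (mtopology_of E) euclideanreal f" and \<eta>: "\<eta> > 0"
    and nonempty: "\<And>n. mspace (En n) \<noteq> {}"
  shows "\<exists>\<delta>>0. \<forall>s\<in>{0..\<delta>}. \<forall>\<^sub>F n in sequentially.
    sup_norm (mspace (En n)) (\<lambda>x. (T n ^^ nat \<lfloor>s / \<epsilon> n\<rfloor>) (f \<circ> \<gamma> n) x - (f \<circ> \<gamma> n) x) \<le> \<eta>"
proof -
  have fm: "f \<in> bounded_measurable BE"
    by (rule continuous_map_bounded_measurable[OF compact_E f])
  have "((\<lambda>t. sup_norm (mspace E) (\<lambda>x. transition_op Y t f x - f x)) \<longlongrightarrow> 0) (at_right 0)"
    using feller f by (simp add: feller_process_def)
  then have "\<forall>\<^sub>F t in at_right 0. sup_norm (mspace E) (\<lambda>x. transition_op Y t f x - f x) < \<eta> / 2"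
    by (rule order_tendstoD(2)) (use \<eta> in simp)
  then obtain \<delta> where \<delta>: "\<delta> > 0"
    and sup: "\<And>s. 0 < s \<Longrightarrow> s < \<delta> \<Longrightarrow> sup_norm (mspace E) (\<lambda>x. transition_op Y s f x - f x) < \<eta> / 2"
    by (auto simp: eventually_at_right_field)
  \<comment> \<open>The right-hand limit says nothing at \<open>s = 0\<close>, where the operator is
    the identity; halving \<open>\<delta>\<close> fits a closed interval into the open one.\<close>
  have close: "\<bar>transition_op Y s f x - f x\<bar> \<le> \<eta> / 2" if "s \<in> {0..\<delta> / 2}" "x \<in> mspace E" for s x
  proof (cases "s = 0")
    case True
    then show ?thesis
      using transition_op_0[OF markov_Y _ bounded_measurableD[OF fm]] that \<eta> by (simp add: space_borel_of)
  next
    case False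
    then have s: "0 < s" "s < \<delta>" using that \<delta> by auto
    have "transition_op Y s f \<in> bounded_measurable BE"
      using s by (intro continuous_map_bounded_measurable[OF compact_E] feller_continuous f) auto
    from bounded_measurable_lincomb[OF fm this, of "- 1"]
    have "bounded ((\<lambda>x. transition_op Y s f x - f x) ` mspace E)"
      by (simp add: bounded_measurable_def space_borel_of)
    from abs_le_sup_norm[OF this that(2)] sup[OF s] show ?thesis by simp
  qed
  have "\<forall>\<^sub>F n in sequentially.
      sup_norm (mspace (En n)) (\<lambda>x. (T n ^^ nat \<lfloor>s / \<epsilon> n\<rfloor>) (f \<circ> \<gamma> n) x - (f \<circ> \<gamma> n) x) \<le> \<eta>"
    if s: "s \<in> {0..\<delta> / 2}" for s
  proof -
    have s0: "s \<ge> 0" using s by simp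
    have "\<forall>\<^sub>F n in sequentially. sup_norm (mspace (En n))
        (\<lambda>x. (T n ^^ nat \<lfloor>s / \<epsilon> n\<rfloor>) (f \<circ> \<gamma> n) x - (transition_op Y s f \<circ> \<gamma> n) x) < \<eta> / 2"
      by (rule order_tendstoD(2)[OF uniform[OF f s0]]) (use \<eta> in simp)
    then show ?thesis
    proof eventually_elim
      case (elim n)
      show ?case
      proof (rule sup_norm_le[OF nonempty])
        fix x assume x: "x \<in> mspace (En n)"
        have "\<bar>(T n ^^ nat \<lfloor>s / \<epsilon> n\<rfloor>) (f \<circ> \<gamma> n) x - (transition_op Y s f \<circ> \<gamma> n) x\<bar> < \<eta> / 2"
          using f s0 x
          by (intro le_less_trans[OF abs_diff_le_sup_norm elim] T.pow_closed
              compose_bounded_measurable feller_continuous)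
        moreover have "\<bar>(transition_op Y s f \<circ> \<gamma> n) x - (f \<circ> \<gamma> n) x\<bar> \<le> \<eta> / 2"
          using close[OF s \<gamma>_mspace[OF x]] by simp
        ultimately show "\<bar>(T n ^^ nat \<lfloor>s / \<epsilon> n\<rfloor>) (f \<circ> \<gamma> n) x - (f \<circ> \<gamma> n) x\<bar> \<le> \<eta>"
          by linarith
      qed
    qed
  qed
  then show ?thesis using \<delta> by (intro exI[of _ "\<delta> / 2"]) auto
qed

lemma tendsto_transition_op_variant:
  assumes Yn': "\<And>n. continuous_time_variant (BEn n) (Yn n) (1 / \<epsilon> n) (Yn' n)"
    and f: "continuous_map (mtopology_of E) euclideanreal f" and t: "t \<ge> 0"
    and yn: "\<And>n. yn n \<in> mspace (En n)"
    and lim: "limitin (mtopology_of E) (\<lambda>n. \<gamma> n (yn n)) y sequentially"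
  shows "(\<lambda>n. transition_op (Yn' n) t (f \<circ> \<gamma> n) (yn n)) \<longlonglongrightarrow> transition_op Y t f y"
proof -
  have F: "f \<circ> \<gamma> n \<in> bounded_measurable (BEn n)" for n
    by (rule compose_bounded_measurable[OF f])
  obtain M where M0: "0 \<le> M" and "\<And>x. x \<in> mspace E \<Longrightarrow> \<bar>f x\<bar> \<le> M"
    using bounded_measurableE[OF continuous_map_bounded_measurable[OF compact_E f]]
    by (metis space_borel_of topspace_mtopology_of)
  then have M: "\<bar>(f \<circ> \<gamma> n) x\<bar> \<le> M" if "x \<in> space (BEn n)" for n x
    using \<gamma>_mspace that by (simp add: space_borel_of)
  have nonempty: "mspace (En n) \<noteq> {}" for n using yn by blast
  have yn': "yn n \<in> space (BEn n)" for n using yn by (simp add: space_borel_of)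
  define a where "a n k = (T n ^^ k) (f \<circ> \<gamma> n) (yn n)" for n k
  define b where "b n j = sup_norm (mspace (En n)) (\<lambda>x. (T n ^^ j) (f \<circ> \<gamma> n) x - (f \<circ> \<gamma> n) x)" for n j
  have "(\<lambda>n. (\<Sum>k. poisson_weight (t / \<epsilon> n) k * a n k) - a n (nat \<lfloor>t / \<epsilon> n\<rfloor>)) \<longlonglongrightarrow> 0"
  proof (rule poisson_average_tendsto[OF \<epsilon>_pos \<epsilon>_tendsto _ _ _ _ t])
    show "\<bar>a n k\<bar> \<le> M" for n k
      unfolding a_def by (rule T.pow_contraction[OF F M yn'])
    \<comment> \<open>Both terms are \<open>T n ^^ k\<close> applied to functions at sup distance
      \<open>b n j\<close>, and that power is a contraction. So the increments are bounded uniformly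
      in \<open>k\<close>.\<close>
    show "\<bar>a n (k + j) - a n k\<bar> \<le> b n j" for n k j
      unfolding a_def b_def funpow_add comp_apply[of "T n ^^ k"]
      by (intro T.pow_diff_le[OF T.pow_closed[OF F] F _ yn'] abs_diff_le_sup_norm T.pow_closed F)
         (simp add: space_borel_of)
    show "b n j \<le> 2 * M" for n j
      unfolding b_def
    proof (rule sup_norm_le[OF nonempty])
      fix x assume "x \<in> mspace (En n)"
      then have x: "x \<in> space (BEn n)" by (simp add: space_borel_of)
      show "\<bar>(T n ^^ j) (f \<circ> \<gamma> n) x - (f \<circ> \<gamma> n) x\<bar> \<le> 2 * M"
        using T.pow_contraction[OF F M x, of j] M[OF x] by linarith
    qed
    show "\<exists>\<delta>>0. \<forall>s\<in>{0..\<delta>}. \<forall>\<^sub>F n in sequentially. b n (nat \<lfloor>s / \<epsilon> n\<rfloor>) \<le> \<eta>" if "\<eta> > 0" for \<eta>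
      unfolding b_def by (rule small_increments[OF f that nonempty])
  qed
  moreover have "a = (\<lambda>n k. (T n ^^ k) (f \<circ> \<gamma> n) (yn n))"
    by (simp add: a_def fun_eq_iff)
  then have "(\<lambda>n. a n (nat \<lfloor>t / \<epsilon> n\<rfloor>)) \<longlonglongrightarrow> transition_op Y t f y"
    using tendsto_pow_transition_op[OF f t yn lim] by simp
  ultimately have "(\<lambda>n. \<Sum>k. poisson_weight (t / \<epsilon> n) k * a n k) \<longlonglongrightarrow> transition_op Y t f y"
    using tendsto_add by fastforce
  \<comment> \<open>The jump rate \<open>1 / \<epsilon> n\<close> turns the elapsed time
    \<open>t\<close> into the Poisson mean \<open>t / \<epsilon> n\<close>.\<close>
  moreover have "transition_op (Yn' n) t (f \<circ> \<gamma> n) (yn n) = (\<Sum>k. poisson_weight (t / \<epsilon> n) k * a n k)" for n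
  proof -
    have "transition_op (Yn' n) t (f \<circ> \<gamma> n) (yn n)
        = op_exp (\<lambda>g y. 1 / \<epsilon> n * (T n g y - g y)) t (f \<circ> \<gamma> n) (yn n)"
      using Yn'[of n] F[of n] yn'[of n] t
      by (simp only: continuous_time_variant_def bounded_measurable_def mem_Collect_eq)
    also have "\<dots> = (\<Sum>k. poisson_weight (t * (1 / \<epsilon> n)) k * a n k)"
      unfolding a_def by (rule T.op_exp_eq_poisson_average[OF F yn'])
    finally show ?thesis by simp
  qed
  ultimately show ?thesis by simp
qed

end

section \<open>The two inequalities for the limit process\<close>

theorem theorem2p7:
  fixes E :: "'e metric"
    and Y :: "(real, 'w, 'e) process"
    and \<nu> :: "'e measure"
    and En :: "nat \<Rightarrow> 'a metric"
    and Yn :: "nat \<Rightarrow> (nat, 'u, 'a) process"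
    and Yn' :: "nat \<Rightarrow> (real, 'v, 'a) process"
    and \<nu>n :: "nat \<Rightarrow> 'a measure"
    and \<gamma> :: "nat \<Rightarrow> 'a \<Rightarrow> 'e"
    and \<epsilon> :: "nat \<Rightarrow> real"
  assumes "compact_space (mtopology_of E)"
    and "feller_process (mtopology_of E) Y"
    and "\<And>n. n \<ge> 1 \<Longrightarrow> compact_space (mtopology_of (En n))"
    and "\<And>n. n \<ge> 1 \<Longrightarrow> markov_process (borel_of (mtopology_of (En n))) (Yn n)"
    and "\<And>n. n \<ge> 1 \<Longrightarrow> continuous_map (mtopology_of (En n)) (mtopology_of E) (\<gamma> n)"
    and "\<And>y. y \<in> mspace E \<Longrightarrow>
           \<exists>yn. (\<forall>n\<ge>1. yn n \<in> mspace (En n)) \<and>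
                limitin (mtopology_of E) (\<lambda>n. \<gamma> n (yn n)) y sequentially"
    and "\<And>n. n \<ge> 1 \<Longrightarrow> unique_stationary (borel_of (mtopology_of (En n))) (Yn n) (\<nu>n n)"
    and "unique_stationary (borel_of (mtopology_of E)) Y \<nu>"
    and "weakly_converges (mtopology_of E)
           (\<lambda>n. distr (\<nu>n n) (borel_of (mtopology_of E)) (\<gamma> n)) \<nu>"
    and "\<And>n. n \<ge> 1 \<Longrightarrow> \<epsilon> n > 0"
    and "\<epsilon> \<longlonglongrightarrow> 0"
    and "\<And>f t. continuous_map (mtopology_of E) euclideanreal f \<Longrightarrow> t \<ge> 0 \<Longrightarrow>
           (\<lambda>n. sup_norm (mspace (En n))
                  (\<lambda>x. (transition_op (Yn n) 1 ^^ nat \<lfloor>t / \<epsilon> n\<rfloor>) (f \<circ> \<gamma> n) x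
                        - (transition_op Y t f \<circ> \<gamma> n) x)) \<longlonglongrightarrow> 0"
    and "\<And>n. n \<ge> 1 \<Longrightarrow>
           continuous_time_variant (borel_of (mtopology_of (En n))) (Yn n) (1 / \<epsilon> n) (Yn' n)"
  shows "\<forall>t\<ge>0.
      ereal (separation_distance (mtopology_of E) Y t)
        \<le> liminf (\<lambda>n. ereal (separation_distance (mtopology_of (En n)) (Yn n) (nat \<lfloor>t / \<epsilon> n\<rfloor>)))
    \<and> ereal (separation_distance (mtopology_of E) Y t)
        \<le> liminf (\<lambda>n. ereal (separation_distance (mtopology_of (En n)) (Yn' n) t))"
proof (intro allI impI)
  fix t :: real assume t: "t \<ge> 0"
  \<comment> \<open>Nothing is assumed about the index 0, hence the shift.\<close>
  interpret approximating_chains E Y "\<lambda>n. En (Suc n)" "\<lambda>n. Yn (Suc n)" "\<lambda>n. \<gamma> (Suc n)" "\<lambda>n. \<epsilon> (Suc n)"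
  proof
    show "(\<lambda>n. sup_norm (mspace (En (Suc n)))
        (\<lambda>x. (transition_op (Yn (Suc n)) 1 ^^ nat \<lfloor>t / \<epsilon> (Suc n)\<rfloor>) (f \<circ> \<gamma> (Suc n)) x
          - (transition_op Y t f \<circ> \<gamma> (Suc n)) x)) \<longlonglongrightarrow> 0"
      if "continuous_map (mtopology_of E) euclideanreal f" "t \<ge> 0" for f t
      using LIMSEQ_Suc[OF assms(12)[OF that]] .
    show "(\<lambda>n. \<epsilon> (Suc n)) \<longlonglongrightarrow> 0"
      using LIMSEQ_Suc[OF assms(11)] .
  qed (use assms in auto)
  have dense: "\<exists>yn. (\<forall>n. yn n \<in> mspace (En (Suc n))) \<and>
      limitin (mtopology_of E) (\<lambda>n. \<gamma> (Suc n) (yn n)) y sequentially" if "y \<in> mspace E" for y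
  proof -
    obtain yn where "\<forall>n\<ge>1. yn n \<in> mspace (En n)"
      and lim: "limitin (mtopology_of E) (\<lambda>n. \<gamma> n (yn n)) y sequentially"
      using assms(6)[OF \<open>y \<in> mspace E\<close>] by blast
    moreover have "limitin (mtopology_of E) (\<lambda>n. \<gamma> (Suc n) (yn (Suc n))) y sequentially"
      using limitin_sequentially_offset[OF lim, of 1] by simp
    ultimately show ?thesis by (intro exI[of _ "\<lambda>n. yn (Suc n)"]) simp
  qed
  have weak: "weakly_converges (mtopology_of E)
      (\<lambda>n. distr (\<nu>n (Suc n)) (borel_of (mtopology_of E)) (\<gamma> (Suc n))) \<nu>"
    unfolding weakly_converges_def
  proof (intro allI impI)
    fix f assume "continuous_map (mtopology_of E) euclideanreal f \<and> bounded (f ` topspace (mtopology_of E))"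
    then have "(\<lambda>n. \<integral>x. f x \<partial>distr (\<nu>n n) BE (\<gamma> n)) \<longlonglongrightarrow> (\<integral>x. f x \<partial>\<nu>)"
      using assms(9) by (simp add: weakly_converges_def)
    from LIMSEQ_Suc[OF this]
    show "(\<lambda>n. \<integral>x. f x \<partial>distr (\<nu>n (Suc n)) BE (\<gamma> (Suc n))) \<longlonglongrightarrow> (\<integral>x. f x \<partial>\<nu>)" .
  qed
  have variant: "continuous_time_variant (BEn n) (Yn (Suc n)) (1 / \<epsilon> (Suc n)) (Yn' (Suc n))" for n
    using assms(13)[of "Suc n"] by simp
  have unique: "unique_stationary (BEn n) (Yn (Suc n)) (\<nu>n (Suc n))" for n
    using assms(7)[of "Suc n"] by simp
  \<comment> \<open>Equal stationary measures let the weak convergence hypothesis serve the variants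
    as well.\<close>
  have unique': "unique_stationary (BEn n) (Yn' (Suc n)) (\<nu>n (Suc n))" for n
    using unique[of n] stationary_continuous_time_variant[OF markov_Yn variant] \<epsilon>_pos
    by (simp add: unique_stationary_def)
  have "ereal (separation_distance (mtopology_of E) Y t)
      \<le> liminf (\<lambda>n. ereal (separation_distance (mtopology_of (En (Suc n))) (Yn (Suc n))
          (nat \<lfloor>t / \<epsilon> (Suc n)\<rfloor>)))"
    by (rule separation_distance_le_liminf[OF compact_E markov_Y markov_Yn continuous_\<gamma> dense unique
          assms(8) weak t _ tendsto_transition_op[OF _ t]]) auto
  moreover have "ereal (separation_distance (mtopology_of E) Y t)
      \<le> liminf (\<lambda>n. ereal (separation_distance (mtopology_of (En (Suc n))) (Yn' (Suc n)) t))"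
  proof (rule separation_distance_le_liminf[OF compact_E markov_Y _ continuous_\<gamma> dense unique'
          assms(8) weak t t tendsto_transition_op_variant[OF variant _ t]])
    show "markov_process (BEn n) (Yn' (Suc n))" for n
      using variant[of n] by (simp add: continuous_time_variant_def)
  qed auto
  \<comment> \<open>A lower limit is unchanged when the term at index 0 is dropped.\<close>
  ultimately show "ereal (separation_distance (mtopology_of E) Y t)
        \<le> liminf (\<lambda>n. ereal (separation_distance (mtopology_of (En n)) (Yn n) (nat \<lfloor>t / \<epsilon> n\<rfloor>)))
    \<and> ereal (separation_distance (mtopology_of E) Y t)
        \<le> liminf (\<lambda>n. ereal (separation_distance (mtopology_of (En n)) (Yn' n) t))"
    using liminf_shift[of "\<lambda>n. ereal (separation_distance (mtopology_of (En n)) (Yn n) (nat \<lfloor>t / \<epsilon> n\<rfloor>))"]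
      liminf_shift[of "\<lambda>n. ereal (separation_distance (mtopology_of (En n)) (Yn' n) t)"]
    by simp
qed

end
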